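(* A connected finite graph $G$ is a-gapless if and only if it is a tree.
   Context: A bigraph $H=([n],[m],E)$ has left part $[n]$, right part $[m]$, edges $E\subseteq[n]\times[m]$, neighborhoods $\mathcal N_H(\cdot)$; its base graph $G_H$ is the graph on $[n]$ where distinct $u,v$ are adjacent iff they share a neighbor in $H$. Equip $[0,1]^m$ with Lebesgue measure $\mu$. A family $\mathcal A=\{A_1,\dots,A_n\}$ of measurable subsets of $[0,1]^m$ conforms with $H$ if each $A_i=B_i\times[0,1]^{[m]\setminus\mathcal N_H(i)}$ with $B_i\subseteq[0,1]^{\mathcal N_H(i)}$ measurable. The interior $\mathcal I(H)$ is the set of $\vec p\in(0,1)^n$ such that $\mu(\bigcap_i([0,1]^m\setminus A_i))>0$ for every such conforming family with $\mu(A_i)=p_i$ for all $i$. For a graph $G$ on $[n]$, the abstract interior $\mathcal I_a(G)$ is the set of $\vec p\in(0,1)^n$ such that for every probability space and events $A_1,\dots,A_n$ with $\Pr(A_i)=p_i$ for which $G$ is a dependency graph (each $A_i$ mutually independent of $\{A_j:j\ne i, j\notin\mathcal N_G(i)\}$), $\Pr(\bigcap_i\overline{A_i})>0$. A bigraph $H$ is gapful if there are $\vec p\in(0,1)^n$ and $\lambda>0$ with $\lambda\vec p\in\mathcal I(H)\setminus\mathcal I_a(G_H)$, and gapless otherwise. A graph $G$ is a-gapful if some bigraph $H$ with $G_H=G$ is gapful, and a-gapless otherwise. *)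

theory Defs
  imports "HOL-Probability.Probability" "Graph_Theory.Graph_Theory"
begin

text \<open>
  A finite simple graph is a \<^const>\<open>pair_graph\<close>: a finite loop-free digraph with a symmetric
  arc relation. In this encoding the walk \<open>u, v, u\<close> counts as a cycle in the sense of
  \<^const>\<open>pre_digraph.cycle\<close>, so \<^const>\<open>tree\<close> is not the notion of an undirected tree (no graph with
  an edge satisfies it). The cycles of the undirected graph are those with at least three arcs.
\<close>

definition undirected_tree :: "nat pair_pre_digraph \<Rightarrow> bool" where
  "undirected_tree G \<longleftrightarrow>
     Digraph_Component.connected G \<and> \<not> (\<exists>c. pre_digraph.cycle G c \<and> 3 \<le> length c)"

record bigraph =
  nleft :: nat
  nright :: nat
  bedges :: "(nat \<times> nat) set"

definition is_bigraph :: "bigraph \<Rightarrow> bool" where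
  "is_bigraph H \<longleftrightarrow> bedges H \<subseteq> {1..nleft H} \<times> {1..nright H}"

definition left_nbrs :: "bigraph \<Rightarrow> nat \<Rightarrow> nat set" where
  "left_nbrs H i = {j. (i, j) \<in> bedges H}"

definition base_graph :: "bigraph \<Rightarrow> nat pair_pre_digraph" where
  "base_graph H = \<lparr> pverts = {1..nleft H},
     parcs = {(u, v). u \<in> {1..nleft H} \<and> v \<in> {1..nleft H} \<and> u \<noteq> v \<and>
                      left_nbrs H u \<inter> left_nbrs H v \<noteq> {}} \<rparr>"

text \<open>
  Lebesgue measure on \<open>[0,1]\<^sup>I\<close>, as a measure on extensional functions on \<open>I\<close>. The completion makes
  the measurable sets the Lebesgue measurable ones rather than only the Borel ones.
\<close>

definition cube :: "nat set \<Rightarrow> (nat \<Rightarrow> real) measure" where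
  "cube I = completion (Pi\<^sub>M I (\<lambda>_. restrict_space lborel {0..1}))"

text \<open>
  The cylinder over \<open>B\<close>, i.e. \<open>B \<times> [0,1]\<^bsup>[m] - N(i)\<^esup>\<close>, is \<^const>\<open>prod_emb\<close>.
\<close>

definition conforms :: "bigraph \<Rightarrow> (nat \<Rightarrow> (nat \<Rightarrow> real) set) \<Rightarrow> bool" where
  "conforms H A \<longleftrightarrow>
     (\<forall>i\<in>{1..nleft H}. \<exists>B\<in>sets (cube (left_nbrs H i)).
        A i = prod_emb {1..nright H} (\<lambda>_. restrict_space lborel {0..1}) (left_nbrs H i) B)"

text \<open>
  A vector in \<open>(0,1)\<^sup>n\<close> is a function on \<^typ>\<open>nat\<close>; values outside the index set are irrelevant.
\<close>

definition bigraph_interior :: "bigraph \<Rightarrow> (nat \<Rightarrow> real) set" where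
  "bigraph_interior H =
     {p \<in> {1..nleft H} \<rightarrow> {0<..<1}.
        \<forall>A. conforms H A \<and> (\<forall>i\<in>{1..nleft H}. measure (cube {1..nright H}) (A i) = p i) \<longrightarrow>
          measure (cube {1..nright H})
            (space (cube {1..nright H}) \<inter>
              (\<Inter>i\<in>{1..nleft H}. space (cube {1..nright H}) - A i)) > 0}"

text \<open>
  Mutual independence of \<open>A i\<close> from a family of events is independence from the
  sigma-algebra which that family generates.
\<close>

definition dependency_graph ::
  "nat pair_pre_digraph \<Rightarrow> 'a measure \<Rightarrow> (nat \<Rightarrow> 'a set) \<Rightarrow> bool" where
  "dependency_graph G M A \<longleftrightarrow>
     (\<forall>i\<in>pverts G. prob_space.indep_set M {A i}
        (sigma_sets (space M) (A ` {j \<in> pverts G. j \<noteq> i \<and> (i, j) \<notin> parcs G})))"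

text \<open>
  A definition cannot quantify over all types of sample points, so the probability spaces range over
  one type, whose points can record which of the events occur. The lemma
  \<open>abstract_interior_any_space\<close> below shows that spaces over all other types are covered as well.
\<close>

definition abstract_interior :: "nat pair_pre_digraph \<Rightarrow> (nat \<Rightarrow> real) set" where
  "abstract_interior G =
     {p \<in> pverts G \<rightarrow> {0<..<1}.
        \<forall>(M :: nat set measure) A.
          prob_space M \<and> A \<in> pverts G \<rightarrow> sets M \<and> (\<forall>i\<in>pverts G. measure M (A i) = p i) \<and>
          dependency_graph G M A \<longrightarrow>
            measure M (space M \<inter> (\<Inter>i\<in>pverts G. space M - A i)) > 0}"

definition gapful :: "bigraph \<Rightarrow> bool" where
  "gapful H \<longleftrightarrow>
     (\<exists>p \<in> {1..nleft H} \<rightarrow> {0<..<1}. \<exists>c>0.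
        (\<lambda>i. c * p i) \<in> bigraph_interior H - abstract_interior (base_graph H))"

definition a_gapful :: "nat pair_pre_digraph \<Rightarrow> bool" where
  "a_gapful G \<longleftrightarrow> (\<exists>H. is_bigraph H \<and> base_graph H = G \<and> gapful H)"

abbreviation a_gapless :: "nat pair_pre_digraph \<Rightarrow> bool" where
  "a_gapless G \<equiv> \<not> a_gapful G"

lemma abstract_interior_any_space:
  fixes M :: "'a measure"
  assumes G: "finite (pverts G)" and p: "p \<in> abstract_interior G"
    and M: "prob_space M" and A: "A \<in> pverts G \<rightarrow> sets M"
    and Ap: "\<forall>i\<in>pverts G. measure M (A i) = p i" and dep: "dependency_graph G M A"
  shows "measure M (space M \<inter> (\<Inter>i\<in>pverts G. space M - A i)) > 0"
proof -
  interpret M: prob_space M by (rule M)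
  define V where "V = pverts G"
  define X where "X = (\<lambda>\<omega>. {i \<in> V. \<omega> \<in> A i})"
  define N where "N = distr M (count_space (Pow V)) X"
  define B where "B = (\<lambda>i. {S \<in> Pow V. i \<in> S})"
  have AV: "A i \<in> sets M" if "i \<in> V" for i using A that by (auto simp: V_def)
  have finV: "finite V" using G by (simp add: V_def)
  have X: "X \<in> measurable M (count_space (Pow V))"
  proof (subst measurable_count_space_eq2)
    show "finite (Pow V)" using finV by simp
    have "X -` {S} \<inter> space M \<in> sets M" if "S \<in> Pow V" for S
    proof -
      have eq: "X -` {S} \<inter> space M = {\<omega> \<in> space M. \<forall>i\<in>V. (\<omega> \<in> A i) = (i \<in> S)}"
        using that by (auto simp: X_def)
      have "{\<omega> \<in> space M. (\<omega> \<in> A i) = (i \<in> S)} \<in> sets M" if "i \<in> V" for i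
      proof (cases "i \<in> S")
        case True
        then have "{\<omega> \<in> space M. (\<omega> \<in> A i) = (i \<in> S)} = A i"
          using sets.sets_into_space[OF AV[OF that]] by auto
        then show ?thesis using AV[OF that] by simp
      next
        case False
        then have "{\<omega> \<in> space M. (\<omega> \<in> A i) = (i \<in> S)} = space M - A i" by auto
        then show ?thesis using AV[OF that] by simp
      qed
      then show ?thesis unfolding eq using finV by (intro sets.sets_Collect_finite_All) auto
    qed
    then show "X \<in> space M \<rightarrow> Pow V \<and> (\<forall>a\<in>Pow V. X -` {a} \<inter> space M \<in> sets M)"
      by (auto simp: X_def)
  qed
  have N: "prob_space N" unfolding N_def by (rule M.prob_space_distr[OF X])
  interpret N: prob_space N by (rule N)
  have spN: "space N = Pow V" and setsN: "sets N = Pow (Pow V)" by (simp_all add: N_def)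
  have mN: "measure N S = measure M (X -` S \<inter> space M)" if "S \<subseteq> Pow V" for S
    unfolding N_def using X that by (intro measure_distr) auto
  have XB: "X -` B i \<inter> space M = A i" if "i \<in> V" for i
    using sets.sets_into_space[OF AV[OF that]] that by (auto simp: X_def B_def)
  have BV: "B i \<subseteq> Pow V" for i by (auto simp: B_def)
  have sig: "S \<subseteq> Pow V \<and> X -` S \<inter> space M \<in> sigma_sets (space M) (A ` J)"
    if "S \<in> sigma_sets (Pow V) (B ` J)" "J \<subseteq> V" for S J
    using that
  proof (induction rule: sigma_sets.induct)
    case (Basic a)
    then obtain j where j: "j \<in> J" "a = B j" by auto
    then show ?case using XB[of j] BV[of j] Basic(2) by (auto intro!: sigma_sets.Basic)
  next
    case Empty
    show ?case by (auto intro: sigma_sets.Empty)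
  next
    case (Compl a)
    have "X -` (Pow V - a) \<inter> space M = space M - (X -` a \<inter> space M)"
      by (auto simp: X_def)
    then show ?case using Compl by (auto intro: sigma_sets.Compl)
  next
    case (Union a)
    have eq: "X -` (\<Union>i. a i) \<inter> space M = (\<Union>i. X -` a i \<inter> space M)" by auto
    have IH: "a i \<subseteq> Pow V" "X -` a i \<inter> space M \<in> sigma_sets (space M) (A ` J)" for i
      using Union by auto
    have "(\<Union>i. a i) \<subseteq> Pow V" using IH(1) by blast
    moreover have "X -` (\<Union>i. a i) \<inter> space M \<in> sigma_sets (space M) (A ` J)"
      unfolding eq by (intro sigma_sets.Union IH(2))
    ultimately show ?case by blast
  qed
  have "dependency_graph G N B"
    unfolding dependency_graph_def
  proof
    fix i assume i: "i \<in> pverts G"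
    define J where "J = {j \<in> pverts G. j \<noteq> i \<and> (i, j) \<notin> parcs G}"
    have JV: "J \<subseteq> V" by (auto simp: J_def V_def)
    have ind: "M.indep_set {A i} (sigma_sets (space M) (A ` J))"
      using dep i unfolding dependency_graph_def J_def by auto
    have "N.indep_set {B i} (sigma_sets (Pow V) (B ` J))"
      unfolding N.indep_sets2_eq
    proof (intro conjI ballI)
      show "{B i} \<subseteq> sets N" using BV by (auto simp: setsN)
      show "sigma_sets (Pow V) (B ` J) \<subseteq> sets N" using sig[OF _ JV] by (auto simp: setsN)
      fix a b assume a: "a \<in> {B i}" and b: "b \<in> sigma_sets (Pow V) (B ` J)"
      have bV: "b \<subseteq> Pow V" and Xb: "X -` b \<inter> space M \<in> sigma_sets (space M) (A ` J)"
        using sig[OF b JV] by auto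
      have iV: "i \<in> V" using i by (simp add: V_def)
      have "measure N (a \<inter> b) = measure M (X -` (B i \<inter> b) \<inter> space M)"
        using a bV by (subst mN) auto
      also have "X -` (B i \<inter> b) \<inter> space M = A i \<inter> (X -` b \<inter> space M)"
        using XB[OF iV] by auto
      also have "measure M \<dots> = measure M (A i) * measure M (X -` b \<inter> space M)"
        using ind Xb unfolding M.indep_sets2_eq by auto
      also have "\<dots> = measure N a * measure N b"
        using a mN[OF bV] mN[OF BV[of i]] XB[OF iV] by simp
      finally show "measure N (a \<inter> b) = measure N a * measure N b" .
    qed
    then show "N.indep_set {B i}
        (sigma_sets (space N) (B ` {j \<in> pverts G. j \<noteq> i \<and> (i, j) \<notin> parcs G}))"
      by (simp add: spN J_def)
  qed
  moreover have "\<forall>i\<in>pverts G. measure N (B i) = p i"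
    using Ap mN[OF BV] XB by (simp add: V_def)
  moreover have "B \<in> pverts G \<rightarrow> sets N" using BV by (auto simp: setsN)
  ultimately have "measure N (space N \<inter> (\<Inter>i\<in>pverts G. space N - B i)) > 0"
    using p N unfolding abstract_interior_def by blast
  also have "measure N (space N \<inter> (\<Inter>i\<in>pverts G. space N - B i)) =
      measure M (X -` (space N \<inter> (\<Inter>i\<in>pverts G. space N - B i)) \<inter> space M)"
    by (rule mN) (auto simp: spN)
  also have "X -` (space N \<inter> (\<Inter>i\<in>pverts G. space N - B i)) \<inter> space M =
      space M \<inter> (\<Inter>i\<in>pverts G. space M - A i)"
    by (auto simp: spN B_def X_def V_def)
  finally show ?thesis .
qed

end

theory Submission
  imports Defs
begin

text \<open>
  In a tree each edge carries its own coordinate. Eliminating vertices from the leaves and giving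
  each vertex \<open>v\<close> the weight \<open>t v = q v / \<Prod> (1 - t u)\<close>, the product over the children \<open>u\<close> of \<open>v\<close>,
  the usual local lemma induction shows that all weights below 1 force a positive avoidance
  probability in every abstract space, whereas at the first weight \<open>\<ge> 1\<close> an explicit family
  of boxes covers the cube.

  If \<open>G\<close> has a cycle, take one coordinate per edge and the uniform vector at which the independence
  polynomial \<open>Z\<close> of \<open>G\<close> first vanishes. Shearer's measure shows that it is outside the abstract
  interior. A conforming family at this vector that covers the cube has the avoidance probabilities
  of Shearer's measure on all proper vertex subsets, so adjacent events are almost disjoint and each
  coordinate is split between the two endpoints of its edge. As \<open>G\<close> is connected with a cycle, its
  vertices can be matched injectively to incident edges; letting each vertex lose on its own edge
  exhibits an uncovered box of positive measure.
\<close>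

section \<open>Acyclic graphs and cycles\<close>

text \<open>Both interiors demand strictly positive avoidance, so no gap has to be estimated: for a
  graph with a cycle it is enough to find one vector at which avoidance can fail in some abstract
  space but never in the cube of one suitable bigraph. Abstract spaces and cubes are compared
  through a single inequality, \<open>f_insert_ge\<close>, which holds in both; the independence
  polynomial satisfies it with equality.

  A tree has to be treated for every bigraph over it. An edge may then offer several coordinates,
  but none is seen by three vertices, since these would form a triangle; one coordinate chosen per
  edge therefore gives distinct coordinates. For a graph with a cycle the bigraph may be chosen, and
  with one coordinate per edge two adjacent events share exactly one coordinate, along which almost
  disjoint events must separate. The cycle is what makes the matching possible: a tree has fewer
  edges than vertices.\<close>

lemma elimination_rank:
  fixes E :: "'a rel"
  assumes "finite V"
    and "\<And>S. S \<subseteq> V \<Longrightarrow> S \<noteq> {} \<Longrightarrow> \<exists>v\<in>S. \<forall>u\<in>S \<inter> E `` {v}. \<forall>w\<in>S \<inter> E `` {v}. u = w"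
  shows "\<exists>rank :: 'a \<Rightarrow> nat. inj_on rank V \<and>
    (\<forall>v\<in>V. \<forall>u\<in>V \<inter> E `` {v}. \<forall>w\<in>V \<inter> E `` {v}. rank v < rank u \<longrightarrow> rank v < rank w \<longrightarrow> u = w)"
  using assms
proof (induction V rule: finite_psubset_induct)
  case (psubset V)
  show ?case
  proof (cases "V = {}")
    case False
    then have "\<exists>v\<in>V. \<forall>u\<in>V \<inter> E `` {v}. \<forall>w\<in>V \<inter> E `` {v}. u = w"
      by (intro psubset.prems) auto
    then obtain v where v: "v \<in> V" "\<forall>u\<in>V \<inter> E `` {v}. \<forall>w\<in>V \<inter> E `` {v}. u = w" ..
    have sub: "V - {v} \<subset> V" using v(1) by auto
    have prem: "\<exists>x\<in>S. \<forall>u\<in>S \<inter> E `` {x}. \<forall>w\<in>S \<inter> E `` {x}. u = w" if "S \<subseteq> V - {v}" "S \<noteq> {}" for S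
      using that by (intro psubset.prems) auto
    obtain r :: "'a \<Rightarrow> nat" where r: "inj_on r (V - {v})"
      "\<forall>x\<in>V - {v}. \<forall>u\<in>(V - {v}) \<inter> E `` {x}. \<forall>w\<in>(V - {v}) \<inter> E `` {x}.
        r x < r u \<longrightarrow> r x < r w \<longrightarrow> u = w"
      using psubset.IH[OF sub prem] by metis
    \<comment> \<open>The removed vertex gets the smallest rank: it has at most one neighbour in all
      of \<open>V\<close>, hence at most one of higher rank, and being lowest it adds no higher
      neighbour to any other vertex. The shift by one keeps the order of the others.\<close>
    define r' where "r' = (\<lambda>x. if x = v then 0 else Suc (r x))"
    have "inj_on r' V" using r(1) by (auto simp: r'_def inj_on_def)
    moreover have "u = w" if "x \<in> V" "u \<in> V \<inter> E `` {x}" "w \<in> V \<inter> E `` {x}" "r' x < r' u" "r' x < r' w" for x u w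
    proof (cases "x = v")
      case True then show ?thesis using v that by blast
    next
      case False
      then have "u \<noteq> v" "w \<noteq> v" "r x < r u" "r x < r w" using that by (auto simp: r'_def split: if_splits)
      then show ?thesis using r(2) that False by blast
    qed
    ultimately show ?thesis by blast
  qed auto
qed

section \<open>Closed walks and cycles\<close>

lemma pcas_walk:
  assumes "i \<le> j"
  shows "pcas (w i) (map (\<lambda>k. (w k, w (Suc k))) [i..<j]) (w j)"
  using assms
proof (induction "j - i" arbitrary: i)
  case (Suc d)
  then have "i < j" by simp
  then show ?case using Suc by (simp add: upt_conv_Cons)
qed simp

lemma tl_pawalk_verts_walk:
  "i < j \<Longrightarrow> tl (pawalk_verts u (map (\<lambda>k. (w k, w (Suc k))) [i..<j])) = map w [Suc i..<Suc j]"
proof -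
  assume "i < j"
  have *: "pawalk_verts u p = (if p = [] then [u] else map fst p @ [snd (last p)])" for u :: 'b and p
    by (induct p arbitrary: u) auto
  obtain j' where j': "j = Suc j'" using \<open>i < j\<close> by (cases j) auto
  have "map w [Suc i..<Suc j'] @ [w (Suc j')] = map w [Suc i..<Suc (Suc j')]"
    using \<open>i < j\<close> j' by simp
  moreover have "tl (map (\<lambda>k. w k) [i..<j]) = map w [Suc i..<j]"
    using \<open>i < j\<close> by (simp add: upt_conv_Cons)
  moreover have "last (map (\<lambda>k. (w k, w (Suc k))) [i..<j]) = (w j', w (Suc j'))"
    using \<open>i < j\<close> j' by (simp add: last_map)
  ultimately show ?thesis using \<open>i < j\<close> j' by (simp add: * o_def del: upt_Suc)
qed

text \<open>A non-backtracking walk in a finite set closes up, and the first time it does so it has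
  run through at least three arcs.\<close>
lemma min_degree_two_cycle:
  fixes G :: "'a pair_pre_digraph"
  assumes G: "pair_graph G" and S: "S \<subseteq> pverts G" "S \<noteq> {}"
    and deg: "\<And>v. v \<in> S \<Longrightarrow> \<exists>u\<in>S \<inter> parcs G `` {v}. \<exists>w\<in>S \<inter> parcs G `` {v}. u \<noteq> w"
  shows "\<exists>c. pre_digraph.cycle G c \<and> 3 \<le> length c"
proof -
  interpret pair_graph G by (rule G)
  define Q where "Q = (\<lambda>a :: 'a \<times> 'a. fst a \<in> S \<and> snd a \<in> S \<and> a \<in> parcs G)"
  \<comment> \<open>The states of the chosen sequence are arcs rather than vertices, so that not
    turning back becomes a condition on two consecutive states.\<close>
  have "\<exists>f. \<forall>n. Q (f n) \<and> fst (f (Suc n)) = snd (f n) \<and> snd (f (Suc n)) \<noteq> fst (f n)"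
  proof (rule dependent_nat_choice)
    show "\<exists>a. Q a" using S(2) deg unfolding Q_def by fastforce
    show "\<exists>b. Q b \<and> fst b = snd a \<and> snd b \<noteq> fst a" if "Q a" for a n
    proof -
      from that have "snd a \<in> S" by (simp add: Q_def)
      then obtain u where "u \<in> S \<inter> parcs G `` {snd a}" "u \<noteq> fst a" using deg by metis
      then show ?thesis using that by (intro exI[of _ "(snd a, u)"]) (auto simp: Q_def)
    qed
  qed
  then obtain f where f: "\<And>n. Q (f n)" "\<And>n. fst (f (Suc n)) = snd (f n)" "\<And>n. snd (f (Suc n)) \<noteq> fst (f n)"
    by auto
  define w where "w = (\<lambda>n. fst (f n))"
  have wS: "w n \<in> S" and wE: "(w n, w (Suc n)) \<in> parcs G" and nb: "w (Suc (Suc n)) \<noteq> w n" for n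
    using f(1)[of n] f(2)[of n] f(3)[of n] f(2)[of "Suc n"] by (auto simp: w_def Q_def)
  have "finite S" using S(1) pair_finite_verts finite_subset by blast
  then have "finite (range w)" using wS by (meson finite_subset image_subsetI)
  then have "\<not> inj w" using finite_imageD by blast
  then have ex: "\<exists>d i. 0 < d \<and> w (i + d) = w i"
    by (metis add.commute injI less_imp_add_positive linorder_neqE_nat)
  \<comment> \<open>The gap is minimised over all starting points at once, so no shorter stretch
    anywhere on the walk returns to its start; this gives the distinctness of the closed
    walk.\<close>
  define d where "d = (LEAST d. \<exists>i. 0 < d \<and> w (i + d) = w i)"
  obtain i where i: "0 < d" "w (i + d) = w i"
    using LeastI_ex[OF ex] unfolding d_def by auto
  have mn: "w (k + e) \<noteq> w k" if "0 < e" "e < d" for e k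
    using not_less_Least that unfolding d_def by blast
  have "w (Suc n) \<noteq> w n" for n using wE[of n] pair_no_loops by fastforce
  then have "d \<noteq> 1" using i by auto
  moreover have "d \<noteq> 2" using i nb by (auto simp: numeral_2_eq_2)
  ultimately have d3: "3 \<le> d" using i by auto
  define p where "p = map (\<lambda>k. (w k, w (Suc k))) [i..<i + d]"
  have "inj_on w {Suc i..<Suc (i + d)}"
  proof (rule linorder_inj_onI')
    fix a b assume "a \<in> {Suc i..<Suc (i + d)}" "b \<in> {Suc i..<Suc (i + d)}" "a < b"
    then have "0 < b - a" "b - a < d" "a + (b - a) = b" by auto
    then show "w a \<noteq> w b" using mn[of "b - a" a] by simp
  qed
  then have "distinct (tl (pawalk_verts (w i) p))"
    unfolding p_def using i by (subst tl_pawalk_verts_walk) (auto simp: distinct_map simp del: upt_Suc)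
  moreover have "awalk (w i) p (w i)"
    unfolding awalk_def using wS wE S pcas_walk[of i "i + d" w] i by (auto simp: p_def)
  ultimately have "cycle p" unfolding cycle_def using d3 by (auto simp: p_def)
  then show ?thesis using d3 by (intro exI[of _ p]) (auto simp: p_def)
qed

text \<open>If no arc entered \<open>W\<close>, symmetry would trap every path that starts in
  \<open>W\<close>. Later proofs use connectedness in this form because it suits arguments about
  maximal vertex sets.\<close>

lemma connected_cut:
  fixes G :: "'a pair_pre_digraph"
  assumes G: "pair_graph G" "Digraph_Component.connected G"
    and W: "W \<subseteq> pverts G" "W \<noteq> {}" "W \<noteq> pverts G"
  shows "\<exists>v\<in>pverts G - W. \<exists>w\<in>W. (v, w) \<in> parcs G"
proof (rule ccontr)
  assume no: "\<not> ?thesis"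
  interpret pair_graph G by (rule G)
  obtain a b where ab: "a \<in> W" "b \<in> pverts G - W" using W by blast
  have "strongly_connected G" using symmetric_connected_imp_strongly_connected G(2) sym_arcs by blast
  then have "a \<rightarrow>\<^sup>*\<^bsub>G\<^esub> b" using ab W by (auto simp: strongly_connected_def)
  then have "b \<in> W"
  proof (induction rule: reachable_induct)
    case base then show ?case using ab by simp
  next
    case (step x y)
    then have "(x, y) \<in> parcs G" by simp
    then have "(y, x) \<in> parcs G" using pair_sym_arcs by (auto simp: symmetric_def elim: symE)
    then show ?case using no step in_arcsD1 by blast
  qed
  then show False using ab by simp
qed

text \<open>Orient the cycle cyclically and every other vertex towards it.\<close>
lemma cycle_imp_nonbacktracking_map:
  fixes G :: "'a pair_pre_digraph"
  assumes G: "pair_graph G" "Digraph_Component.connected G"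
    and c: "pre_digraph.cycle G c" "3 \<le> length c"
  shows "\<exists>\<sigma>. \<forall>v\<in>pverts G. (v, \<sigma> v) \<in> parcs G \<and> \<sigma> (\<sigma> v) \<noteq> v"
proof -
  interpret pair_graph G by (rule G)
  define P where "P = (\<lambda>W. W \<noteq> {} \<and> W \<subseteq> pverts G \<and>
    (\<exists>\<sigma>. \<forall>v\<in>W. \<sigma> v \<in> W \<and> (v, \<sigma> v) \<in> parcs G \<and> \<sigma> (\<sigma> v) \<noteq> v))"
  obtain u where u: "awalk u c u" "distinct (tl (pawalk_verts u c))" using c(1) unfolding cycle_def by auto
  define k where "k = length c"
  have k: "3 \<le> k" using c by (simp add: k_def)
  define w where "w = (\<lambda>i. fst (c ! (i mod k)))"
  have cas: "snd (c ! i) = fst (c ! ((Suc i) mod k))" if "i < k" for i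
  proof -
    have 1: "pcas x p y \<Longrightarrow> Suc j < length p \<Longrightarrow> snd (p ! j) = fst (p ! Suc j)" for x p y j
    proof (induction p arbitrary: x j)
      case (Cons a p)
      show ?case
      proof (cases j)
        case 0 then show ?thesis using Cons by (cases p) auto
      next
        case (Suc j') then show ?thesis using Cons by auto
      qed
    qed simp
    have 2: "pcas x p y \<Longrightarrow> p \<noteq> [] \<Longrightarrow> fst (p ! 0) = x \<and> snd (last p) = y" for x p y
    proof (induction p arbitrary: x)
      case (Cons a p) then show ?case by (cases p) auto
    qed simp
    have cc: "pcas u c u" using u(1) by (simp add: awalk_def)
    show ?thesis
    proof (cases "Suc i = k")
      case True
      then have "c ! i = last c" using k_def by (metis diff_Suc_1 last_conv_nth list.size(3) nat.simps(3))
      moreover have "c \<noteq> []" using c(2) by auto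
      ultimately show ?thesis using 2[OF cc] True by simp
    next
      case False
      then show ?thesis using 1[OF cc, of i] that k_def by auto
    qed
  qed
  have cw: "c ! i = (w i, w (Suc i))" if "i < k" for i
    using cas[OF that] that by (auto simp: w_def prod_eq_iff)
  \<comment> \<open>A cycle is defined through distinct heads of its arcs. In a closed walk heads
    and tails form the same multiset, so the tails are distinct as well.\<close>
  have dist: "distinct (map fst c)"
  proof -
    have "pawalk_verts u c = map fst c @ [snd (last c)]" for u
      using c(2) awalk_verts_conv[of u c] by auto
    moreover have "pawalk_verts u c = u # map snd c"
      using awalk_verts_conv'[of u c u] u(1) c(2) by (cases c) (auto simp: awalk_def)
    ultimately have eq: "map fst c @ [snd (last c)] = u # map snd c" by simp
    have "distinct (map snd c)" using u(2) \<open>pawalk_verts u c = u # map snd c\<close> by simp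
    moreover have "mset (map fst c) = mset (map snd c)"
    proof -
      have "snd (last c) = u" using u(1) awlast_if_cas \<open>pawalk_verts u c = map fst c @ _\<close> by fastforce
      then have "mset (map fst c) + {#u#} = {#u#} + mset (map snd c)"
        using arg_cong[OF eq, of mset] by simp
      then show ?thesis by simp
    qed
    ultimately show ?thesis by (metis mset_eq_imp_distinct_iff)
  qed
  have winj: "i mod k = j mod k" if "w i = w j" for i j
  proof -
    have "i mod k < length c" "j mod k < length c" using c(2) mod_less_divisor unfolding k_def by (metis gr0I not_numeral_le_zero)+
    then show ?thesis using that dist nth_eq_iff_index_eq[OF dist, of "i mod k" "j mod k"] by (simp add: w_def)
  qed
  have wE: "(w i, w (Suc i)) \<in> parcs G" for i
  proof -
    have "c ! (i mod k) \<in> set c" using k by (auto simp: k_def intro!: nth_mem mod_less_divisor)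
    then have "c ! (i mod k) \<in> parcs G" using u(1) by (auto simp: awalk_def)
    moreover have "c ! (i mod k) = (w (i mod k), w (Suc (i mod k)))" using k by (intro cw) simp
    moreover have "w (i mod k) = w i" "w (Suc (i mod k)) = w (Suc i)"
      unfolding w_def by (simp_all only: mod_Suc_eq mod_mod_trivial)
    ultimately show ?thesis by simp
  qed
  have "P (range w)"
  proof -
    \<comment> \<open>Any position of a vertex on the cycle will do: two such positions agree modulo
      \<open>k\<close>, so the successor does not depend on the choice.\<close>
    define ix where "ix = (\<lambda>v. SOME i. w i = v)"
    define \<sigma> where "\<sigma> = (\<lambda>v. w (Suc (ix v)))"
    have ix: "w (ix (w i)) = w i" for i unfolding ix_def by (rule someI) simp
    have s: "\<sigma> (w i) = w (Suc i)" for i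
    proof -
      have "Suc (ix (w i)) mod k = Suc i mod k" using winj[OF ix[of i]] mod_Suc_eq by metis
      then show ?thesis unfolding \<sigma>_def w_def by (simp only:)
    qed
    \<comment> \<open>Here the length of at least three matters: returning after two steps would
      make \<open>k\<close> divide 2.\<close>
    have "w (Suc (Suc i)) \<noteq> w i" for i
    proof
      assume "w (Suc (Suc i)) = w i"
      then have "(i + 2) mod k = i mod k" using winj by (metis add_2_eq_Suc')
      then have "k dvd 2" by (metis add_diff_cancel_left' le_add1 mod_eq_dvd_iff_nat)
      then show False using k by (auto dest: dvd_imp_le)
    qed
    then have "\<forall>v\<in>range w. \<sigma> v \<in> range w \<and> (v, \<sigma> v) \<in> parcs G \<and> \<sigma> (\<sigma> v) \<noteq> v"
      using s wE by auto
    then show ?thesis unfolding P_def using wE in_arcsD1 by auto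
  qed
  moreover have "\<forall>W. P W \<longrightarrow> card W < Suc (card (pverts G))"
    using pair_finite_verts by (auto simp: P_def less_Suc_eq_le intro: card_mono)
  ultimately have "\<exists>W. P W \<and> (\<forall>W'. P W' \<longrightarrow> card W' \<le> card W)" by (rule ex_has_greatest_nat)
  then obtain W where W: "P W" and mx: "\<And>W'. P W' \<Longrightarrow> card W' \<le> card W" by auto
  have "W = pverts G"
  proof (rule ccontr)
    assume ne: "W \<noteq> pverts G"
    obtain \<sigma> where s: "\<forall>v\<in>W. \<sigma> v \<in> W \<and> (v, \<sigma> v) \<in> parcs G \<and> \<sigma> (\<sigma> v) \<noteq> v" using W by (auto simp: P_def)
    obtain v x where v: "v \<in> pverts G - W" "x \<in> W" "(v, x) \<in> parcs G"
      using connected_cut[OF G, of W] W ne by (auto simp: P_def)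
    have "\<forall>y\<in>insert v W. (\<sigma>(v := x)) y \<in> insert v W \<and> (y, (\<sigma>(v := x)) y) \<in> parcs G \<and> (\<sigma>(v := x)) ((\<sigma>(v := x)) y) \<noteq> y"
    proof
      fix y assume y: "y \<in> insert v W"
      show "(\<sigma>(v := x)) y \<in> insert v W \<and> (y, (\<sigma>(v := x)) y) \<in> parcs G \<and> (\<sigma>(v := x)) ((\<sigma>(v := x)) y) \<noteq> y"
      proof (cases "y = v")
        case True
        then have "\<sigma> x \<in> W" "x \<noteq> v" using s v by auto
        then show ?thesis using True v by auto
      next
        case False
        then have "y \<in> W" using y by simp
        then have "\<sigma> y \<noteq> v" using s v by auto
        then show ?thesis using False s \<open>y \<in> W\<close> by auto
      qed
    qed
    then have "P (insert v W)" using v W unfolding P_def by blast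
    moreover have "finite W" using W finite_subset[OF _ pair_finite_verts] unfolding P_def by blast
    ultimately show False using mx[of "insert v W"] v by simp
  qed
  then show ?thesis using W by (auto simp: P_def)
qed

section \<open>Avoidance probabilities and the independence polynomial\<close>

text \<open>Well-founded recursion on \<open>rank\<close>. Division is total, so the equation holds
  everywhere, but a weight is meaningful only while the weights below it stay less than 1.\<close>

lemma ex_tree_weights:
  fixes q :: "'a \<Rightarrow> real" and rank :: "'a \<Rightarrow> nat"
  shows "\<exists>t. \<forall>v. t v = q v / (\<Prod>u\<in>{u \<in> V \<inter> E `` {v}. rank u < rank v}. 1 - t u)"
proof -
  define H where "H = (\<lambda>t v. q v / (\<Prod>u\<in>{u \<in> V \<inter> E `` {v}. rank u < rank v}. 1 - t u))"
  have "wfrec (inv_image less_than rank) H v = H (wfrec (inv_image less_than rank) H) v" for v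
    by (subst wfrec[OF wf_inv_image[OF wf_less_than]]) (auto simp: H_def cut_apply intro!: prod.cong arg_cong[where f = "\<lambda>x. q v / x"])
  then show ?thesis by (auto simp: H_def)
qed

text \<open>Here \<open>f S\<close> stands for the probability that no event with index in \<open>S\<close> occurs.\<close>
locale avoidance =
  fixes V :: "'a set" and E :: "'a rel" and q :: "'a \<Rightarrow> real" and f :: "'a set \<Rightarrow> real"
  assumes fin: "finite V"
    and sym: "(u, v) \<in> E \<Longrightarrow> (v, u) \<in> E"
    and irrefl: "(v, v) \<notin> E"
    and q_pos: "v \<in> V \<Longrightarrow> 0 < q v"
    and f_empty: "f {} = 1"
    and f_nonneg: "0 \<le> f S"
    and f_insert_ge: "S \<subseteq> V \<Longrightarrow> v \<in> V - S \<Longrightarrow> f S - q v * f (S - E `` {v}) \<le> f (insert v S)"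
begin

context
  fixes rank :: "'a \<Rightarrow> nat" and t :: "'a \<Rightarrow> real"
  assumes rank_inj: "inj_on rank V"
    and rank_up: "v \<in> V \<Longrightarrow> u \<in> V \<Longrightarrow> (v, u) \<in> E \<Longrightarrow> w \<in> V \<Longrightarrow> (v, w) \<in> E \<Longrightarrow>
      rank v < rank u \<Longrightarrow> rank v < rank w \<Longrightarrow> u = w"
    and t_eq: "v \<in> V \<Longrightarrow> t v = q v / (\<Prod>u\<in>{u \<in> V \<inter> E `` {v}. rank u < rank v}. 1 - t u)"
    and t_less: "v \<in> V \<Longrightarrow> t v < 1"
begin

lemma t_pos: "v \<in> V \<Longrightarrow> 0 < t v"
  by (subst t_eq) (auto intro!: divide_pos_pos prod_pos q_pos simp: t_less)

text \<open>\<open>t v\<close> bounds the conditional probability of the event at \<open>v\<close>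
  given that the events in \<open>S\<close> are avoided. The last hypothesis keeps the parent of
  \<open>v\<close> out of \<open>S\<close>, so only children have to be removed and restored, each
  at the cost of a factor \<open>1 - t c\<close>.\<close>

lemma f_insert_ge_mult:
  assumes "S \<subseteq> V" "v \<in> V - S" "\<And>u. u \<in> S \<inter> E `` {v} \<Longrightarrow> rank u < rank v"
  shows "(1 - t v) * f S \<le> f (insert v S)"
  using finite_subset[OF assms(1) fin] assms
proof (induction S arbitrary: v rule: finite_psubset_induct)
  case (psubset S)
  define C where "C = S \<inter> E `` {v}"
  define K where "K = {u \<in> V \<inter> E `` {v}. rank u < rank v}"
  have finC: "finite C" and CK: "C \<subseteq> K" and finK: "finite K"
    using psubset fin by (auto simp: C_def K_def)
  have peel: "(\<Prod>c\<in>C'. 1 - t c) * f (S - C) \<le> f ((S - C) \<union> C')" if "C' \<subseteq> C" for C'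
    using finite_subset[OF that finC] that
  proof (induction C' rule: finite_induct)
    case (insert c C')
    define S' where "S' = (S - C) \<union> C'"
    have S': "S' \<subset> S" "c \<in> V - S'" using insert psubset.prems(1) by (auto simp: S'_def C_def)
    have "(1 - t c) * f S' \<le> f (insert c S')"
    proof (rule psubset.IH[OF S'(1) _ S'(2)])
      show "S' \<subseteq> V" using S' psubset.prems by auto
      fix u assume u: "u \<in> S' \<inter> E `` {c}"
      have c: "c \<in> V" "rank c < rank v" "(c, v) \<in> E" using insert.prems CK sym by (auto simp: K_def)
      have uV: "u \<in> V" "(c, u) \<in> E" "u \<noteq> v" "u \<noteq> c" using u S' psubset.prems by auto
      then have "rank u \<noteq> rank c" using rank_inj c by (auto dest: inj_onD)
      \<comment> \<open>The only neighbour of \<open>c\<close> with higher rank is \<open>v\<close>,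
        which lies outside \<open>S'\<close>.\<close>
      moreover have "\<not> rank c < rank u"
        using rank_up[of c u v] c uV psubset.prems(2) by auto
      ultimately show "rank u < rank c" by simp
    qed
    moreover have "(1 - t c) * ((\<Prod>c\<in>C'. 1 - t c) * f (S - C)) \<le> (1 - t c) * f S'"
      using insert S'(2) t_less[of c] by (intro mult_left_mono) (auto simp: S'_def)
    ultimately show ?case using insert by (simp add: S'_def mult.assoc)
  qed simp
  have K1: "0 < (\<Prod>u\<in>K. 1 - t u)" by (intro prod_pos) (auto simp: K_def t_less)
  have "(\<Prod>u\<in>K. 1 - t u) = (\<Prod>u\<in>C. 1 - t u) * (\<Prod>u\<in>K - C. 1 - t u)"
    using CK finK by (metis prod.subset_diff mult.commute)
  \<comment> \<open>The weight \<open>t v\<close> involves all children of \<open>v\<close>, whereas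
    only those in \<open>S\<close> were restored; the remaining factors lie between 0 and 1 and can
    only help.\<close>
  moreover have "(\<Prod>u\<in>K - C. 1 - t u) \<le> 1"
    using t_pos t_less by (intro prod_le_1) (auto simp: K_def less_imp_le)
  moreover have "0 < (\<Prod>u\<in>C. 1 - t u)" using CK by (intro prod_pos) (auto simp: K_def t_less)
  ultimately have "(\<Prod>u\<in>K. 1 - t u) \<le> (\<Prod>u\<in>C. 1 - t u)" by (simp add: mult_left_le)
  then have "(\<Prod>u\<in>K. 1 - t u) * f (S - C) \<le> (\<Prod>u\<in>C. 1 - t u) * f (S - C)"
    by (intro mult_right_mono f_nonneg)
  also have "\<dots> \<le> f S"
  proof -
    have "S - C \<union> C = S" by (auto simp: C_def)
    then show ?thesis using peel[of C] by simp
  qed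
  finally have "(\<Prod>u\<in>K. 1 - t u) * f (S - C) \<le> f S" .
  then have "f (S - C) \<le> f S / (\<Prod>u\<in>K. 1 - t u)" using K1 by (simp add: field_simps)
  then have "q v * f (S - C) \<le> q v * (f S / (\<Prod>u\<in>K. 1 - t u))"
    using q_pos[of v] psubset.prems by (intro mult_left_mono) auto
  also have "\<dots> = t v * f S" using t_eq[of v] psubset.prems by (simp add: K_def)
  finally have "f S - t v * f S \<le> f S - q v * f (S - E `` {v})" by (simp add: C_def Diff_Int)
  also have "\<dots> \<le> f (insert v S)" using psubset.prems by (intro f_insert_ge) auto
  finally show ?case by (simp add: algebra_simps)
qed

text \<open>When vertices are added by increasing rank, the neighbours already present are children,
  so each step costs only the positive factor \<open>1 - t v\<close>.\<close>

lemma tree_avoidance_pos: "0 < f V"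
proof -
  have "0 < f {v \<in> V. rank v < k}" for k
  proof (induction k)
    case (Suc k)
    show ?case
    proof (cases "\<exists>v\<in>V. rank v = k")
      case False
      then have "{v \<in> V. rank v < Suc k} = {v \<in> V. rank v < k}" by (auto simp: less_Suc_eq)
      then show ?thesis using Suc by simp
    next
      case True
      then obtain v where v: "v \<in> V" "rank v = k" by auto
      have eq: "{v \<in> V. rank v < Suc k} = insert v {v \<in> V. rank v < k}"
        using v rank_inj by (auto simp: less_Suc_eq dest: inj_onD)
      have "(1 - t v) * f {v \<in> V. rank v < k} \<le> f (insert v {v \<in> V. rank v < k})"
        using v by (intro f_insert_ge_mult) auto
      moreover have "0 < (1 - t v) * f {v \<in> V. rank v < k}" using Suc t_less[OF v(1)] by simp
      ultimately show ?thesis unfolding eq by linarith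
    qed
  qed (simp add: f_empty)
  moreover obtain k where "\<forall>v\<in>V. rank v < k"
    using fin finite_nat_set_iff_bounded[of "rank ` V"] by auto
  ultimately show ?thesis by (metis (mono_tags, lifting) Collect_cong Collect_mem_eq)
qed

end
end

section \<open>The independence polynomial\<close>

definition indep_in :: "'a rel \<Rightarrow> 'a set \<Rightarrow> bool" where
  "indep_in E I \<longleftrightarrow> (\<forall>u\<in>I. \<forall>w\<in>I. (u, w) \<notin> E)"

text \<open>This is the multivariate independence polynomial of the subgraph induced on
  \<open>S\<close>, evaluated at \<open>- q\<close>, as in Shearer's theorem.\<close>

definition indep_poly :: "'a rel \<Rightarrow> ('a \<Rightarrow> real) \<Rightarrow> 'a set \<Rightarrow> real" where
  "indep_poly E q S = (\<Sum>I\<in>{I \<in> Pow S. indep_in E I}. \<Prod>i\<in>I. - q i)"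

lemma indep_poly_empty [simp]: "indep_poly E q {} = 1"
  by (simp add: indep_poly_def indep_in_def Collect_conv_if)

text \<open>Split the independent sets according to whether they contain \<open>v\<close>. The
  recurrence is \<open>f_insert_ge\<close> with equality, which makes the polynomial the benchmark
  for avoidance probabilities.\<close>

lemma indep_poly_insert:
  assumes "finite S" "v \<notin> S" and "\<And>u v. (u, v) \<in> E \<Longrightarrow> (v, u) \<in> E" and "(v, v) \<notin> E"
  shows "indep_poly E q (insert v S) = indep_poly E q S - q v * indep_poly E q (S - E `` {v})"
proof -
  define A where "A = {I \<in> Pow S. indep_in E I}"
  define B where "B = {I \<in> Pow (S - E `` {v}). indep_in E I}"
  have eq: "{I \<in> Pow (insert v S). indep_in E I} = A \<union> insert v ` B"
  proof (intro equalityI subsetI)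
    fix I assume I: "I \<in> {I \<in> Pow (insert v S). indep_in E I}"
    show "I \<in> A \<union> insert v ` B"
    proof (cases "v \<in> I")
      case True
      then have "I = insert v (I - {v})" "I - {v} \<in> B"
        using I by (auto simp: B_def indep_in_def)
      then show ?thesis by blast
    qed (use I in \<open>auto simp: A_def\<close>)
  next
    fix I assume "I \<in> A \<union> insert v ` B"
    then show "I \<in> {I \<in> Pow (insert v S). indep_in E I}"
      using assms by (auto simp: A_def B_def indep_in_def)
  qed
  have "(\<Sum>I\<in>insert v ` B. \<Prod>i\<in>I. - q i) = (\<Sum>I\<in>B. \<Prod>i\<in>insert v I. - q i)"
    using assms(2) by (subst sum.reindex) (auto simp: inj_on_def B_def)
  also have "\<dots> = (\<Sum>I\<in>B. - q v * (\<Prod>i\<in>I. - q i))"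
    using assms(1,2) finite_subset by (intro sum.cong refl prod.insert) (auto simp: B_def)
  finally have "(\<Sum>I\<in>insert v ` B. \<Prod>i\<in>I. - q i) = - q v * (\<Sum>I\<in>B. \<Prod>i\<in>I. - q i)"
    by (simp add: sum_distrib_left)
  moreover have "A \<inter> insert v ` B = {}" "finite A" "finite B" using assms by (auto simp: A_def B_def)
  ultimately show ?thesis
    unfolding indep_poly_def eq by (subst sum.union_disjoint) (auto simp: A_def B_def)
qed

context avoidance
begin

text \<open>The ratio \<open>f / Z\<close> is monotone, and a covering family at a first zero of \<open>Z\<close> forces it to be
  constant below each \<open>V - {u}\<close>: the set \<open>W\<close> of vertices that can be removed without changing it
  is closed under adjacency.\<close>
lemma avoidance_eq_indep_poly:
  fixes Z defines "Z \<equiv> indep_poly E q"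
  assumes f0: "f V = 0" and Z0: "Z V = 0"
    and Zpos: "\<And>S. S \<subset> V \<Longrightarrow> 0 < Z S"
    and conn: "\<And>W. W \<subseteq> V \<Longrightarrow> W \<noteq> {} \<Longrightarrow> W \<noteq> V \<Longrightarrow> \<exists>v\<in>V - W. \<exists>w\<in>W. (v, w) \<in> E"
    and S: "S \<subset> V"
  shows "f S = Z S"
proof -
  define g where "g = (\<lambda>S. f S / Z S)"
  have Zins: "Z (insert v S) = Z S - q v * Z (S - E `` {v})" if "S \<subseteq> V" "v \<in> V - S" for v S
    unfolding Z_def using that fin sym irrefl by (intro indep_poly_insert) (auto intro: finite_subset)
  have fg: "f S = Z S * g S" if "S \<subset> V" for S using Zpos[OF that] by (simp add: g_def)
  \<comment> \<open>Subtracting the recurrence for \<open>Z\<close>, multiplied by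
    \<open>g S\<close>, from \<open>f_insert_ge\<close> leaves an increment of \<open>g\<close> with
    a positive factor. Growth of \<open>g\<close> on smaller sets thus passes to larger
    ones.\<close>
  have step: "Z (insert v S) * g S + q v * Z (S - E `` {v}) * (g S - g (S - E `` {v})) \<le> f (insert v S)"
    if "S \<subset> V" "v \<in> V - S" for v S
  proof -
    have "S - E `` {v} \<subset> V" using that by auto
    have "g S * (Z (insert v S) + q v * Z (S - E `` {v})) = g S * Z S" using Zins[of S v] that by simp
    moreover have "f S - q v * f (S - E `` {v}) \<le> f (insert v S)" using that by (intro f_insert_ge) auto
    ultimately show ?thesis using fg[OF that(1)] fg[OF \<open>S - E `` {v} \<subset> V\<close>]
      by (simp add: algebra_simps)
  qed
  have mono: "g T \<le> g S" if "T \<subseteq> S" "S \<subset> V" for S T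
  proof -
    have "finite S" using that fin finite_subset by blast
    then show ?thesis using that
    proof (induction S arbitrary: T rule: finite_psubset_induct)
      case (psubset S)
      show ?case
      proof (cases "T = S")
        case False
        then obtain v where v: "v \<in> S" "v \<notin> T" using psubset by auto
        define S' where "S' = S - {v}"
        have S': "S' \<subset> S" "S' \<subset> V" "v \<in> V - S'" "S = insert v S'" "T \<subseteq> S'"
          using v psubset.prems by (auto simp: S'_def)
        have "g (S' - E `` {v}) \<le> g S'" using S' by (intro psubset.IH) auto
        moreover have "0 < q v * Z (S' - E `` {v})"
        proof -
          have "S' - E `` {v} \<subset> V" using S' by auto
          then show ?thesis using q_pos[of v] Zpos S' by auto
        qed
        ultimately have "Z S * g S' \<le> f S"
          using step[of S' v] S' by (smt (verit) mult_nonneg_nonneg)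
        then have "g S' \<le> g S" using fg[of S] Zpos[of S] psubset.prems by simp
        moreover have "g T \<le> g S'" using S' by (intro psubset.IH) auto
        ultimately show ?thesis by simp
      qed simp
    qed
  qed
  have nonpos_factor: "b \<le> 0" if "a * b \<le> 0" "0 < a" for a b :: real
    using that by (simp add: mult_le_0_iff)
  have g_empty: "g {} = 1" by (simp add: g_def Z_def f_empty)
  obtain u where u: "u \<in> V" "S \<subseteq> V - {u}" using S by auto
  define c where "c = g (V - {u})"
  have Vu: "V - {u} \<subset> V" using u by auto
  have c_le: "g T \<le> c" if "T \<subseteq> V - {u}" for T unfolding c_def using that Vu by (intro mono) auto
  \<comment> \<open>Since \<open>W\<close> contains all neighbours of \<open>u\<close>, a vertex
    \<open>y\<close> of \<open>W\<close> with a neighbour outside \<open>W\<close> differs from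
    \<open>u\<close>. Hence \<open>insert y (V - W)\<close> stays inside \<open>V - {u}\<close>,
    where \<open>c_le\<close> applies.\<close>
  define P where "P = (\<lambda>W. insert u (V \<inter> E `` {u}) \<subseteq> W \<and> W \<subseteq> V \<and> g (V - W) = c)"
  have "P (insert u (V \<inter> E `` {u}))"
  proof -
    have ss: "V - {u} - E `` {u} \<subset> V" using u by auto
    have Zu: "Z V = Z (V - {u}) - q u * Z (V - {u} - E `` {u})"
      using Zins[of "V - {u}" u] u by (simp add: insert_absorb)
    have fu: "f (V - {u}) - q u * f (V - {u} - E `` {u}) \<le> f V"
      using f_insert_ge[of "V - {u}" u] u by (simp add: insert_absorb)
    have "q u * Z (V - {u} - E `` {u}) * (g (V - {u}) - g (V - {u} - E `` {u})) \<le> 0"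
    proof -
      have "q u * Z (V - {u} - E `` {u}) = Z (V - {u})" using Zu Z0 by simp
      moreover have "q u * f (V - {u} - E `` {u}) = q u * Z (V - {u} - E `` {u}) * g (V - {u} - E `` {u})"
        using fg[OF ss] by simp
      ultimately show ?thesis using fu f0 fg[OF Vu] by (simp add: right_diff_distrib)
    qed
    moreover have "0 < q u * Z (V - {u} - E `` {u})" using q_pos[OF u(1)] Zpos[OF ss] by simp
    ultimately have "g (V - {u}) \<le> g (V - {u} - E `` {u})"
      using nonpos_factor by fastforce
    moreover have "V - insert u (V \<inter> E `` {u}) = V - {u} - E `` {u}" by auto
    ultimately show ?thesis unfolding P_def using u c_le[of "V - {u} - E `` {u}"] by (auto simp: c_def)
  qed
  moreover have "\<forall>W. P W \<longrightarrow> card W < Suc (card V)"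
    using fin by (auto simp: P_def less_Suc_eq_le intro: card_mono)
  ultimately have "\<exists>W. P W \<and> (\<forall>W'. P W' \<longrightarrow> card W' \<le> card W)" by (rule ex_has_greatest_nat)
  then obtain W where W: "P W" and mx: "\<And>W'. P W' \<Longrightarrow> card W' \<le> card W" by auto
  have "W = V"
  proof (rule ccontr)
    assume "W \<noteq> V"
    moreover have WV: "W \<subseteq> V" "u \<in> W" using W by (auto simp: P_def)
    ultimately obtain x y where xy: "x \<in> V - W" "y \<in> W" "(x, y) \<in> E" using conn[of W] by auto
    have yu: "y \<noteq> u" using xy W sym by (auto simp: P_def)
    have yV: "y \<in> V - (V - W)" "V - W \<subset> V" and ss: "V - W - E `` {y} \<subset> V" using xy WV by auto
    have ins: "insert y (V - W) \<subset> V" using yu WV xy by auto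
    have "g (insert y (V - W)) \<le> c" using yu WV xy by (intro c_le) auto
    moreover have "c \<le> g (V - W)" using W by (simp add: P_def)
    ultimately have "Z (insert y (V - W)) * g (insert y (V - W)) \<le> Z (insert y (V - W)) * g (V - W)"
      using Zpos[OF ins] by (intro mult_left_mono) auto
    \<comment> \<open>The maximum \<open>c\<close> is already attained at \<open>V - W\<close>, so
      inserting \<open>y\<close> cannot raise \<open>g\<close>; \<open>step\<close> then leaves no
      room for a positive increment.\<close>
    then have "q y * Z (V - W - E `` {y}) * (g (V - W) - g (V - W - E `` {y})) \<le> 0"
      using step[OF yV(2,1)] fg[OF ins] by simp
    moreover have "0 < q y * Z (V - W - E `` {y})" using q_pos[of y] Zpos[OF ss] WV xy by auto
    ultimately have "c \<le> g (V - W - E `` {y})"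
      using W nonpos_factor by (fastforce simp: P_def)
    moreover have "g (V - W - E `` {y}) \<le> c" using WV by (intro c_le) auto
    moreover have "V - (W \<union> V \<inter> E `` {y}) = V - W - E `` {y}" by auto
    ultimately have "P (W \<union> V \<inter> E `` {y})" using W by (auto simp: P_def)
    then have "card (W \<union> V \<inter> E `` {y}) \<le> card W" by (rule mx)
    moreover have "card W < card (W \<union> V \<inter> E `` {y})"
      using xy sym WV fin by (intro psubset_card_mono) (auto intro: finite_subset)
    ultimately show False by simp
  qed
  \<comment> \<open>With every vertex removed, \<open>g\<close> is evaluated at the empty set, where
    \<open>f\<close> and \<open>Z\<close> are both 1. Monotonicity squeezes \<open>g S\<close>
    between this value and \<open>c\<close>.\<close>
  then have "c = 1" using W g_empty by (simp add: P_def)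
  then have "g S = 1" using mono[of "{}" S] S c_le[OF u(2)] g_empty by simp
  then show ?thesis using fg[OF S] by simp
qed

end

text \<open>A minimal zero \<open>S\<close> of the independence polynomial must be all of \<open>V\<close>: adding a vertex
  adjacent to \<open>S\<close> would make it negative.\<close>
lemma indep_poly_first_zero:
  fixes q :: "'a \<Rightarrow> real"
  assumes fin: "finite V" and sym: "\<And>u v. (u, v) \<in> E \<Longrightarrow> (v, u) \<in> E" and irrefl: "\<And>v. (v, v) \<notin> E"
    and q: "\<And>v. v \<in> V \<Longrightarrow> 0 < q v"
    and conn: "\<And>W. W \<subseteq> V \<Longrightarrow> W \<noteq> {} \<Longrightarrow> W \<noteq> V \<Longrightarrow> \<exists>v\<in>V - W. \<exists>w\<in>W. (v, w) \<in> E"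
    and nn: "\<And>S. S \<subseteq> V \<Longrightarrow> 0 \<le> indep_poly E q S"
    and zero: "S \<subseteq> V" "indep_poly E q S = 0"
  shows "S = V"
proof -
  have "finite S" using zero(1) fin finite_subset by blast
  then show ?thesis using zero
  proof (induction S rule: finite_psubset_induct)
    case (psubset S)
    show ?case
    proof (rule ccontr)
      assume "S \<noteq> V"
      moreover have "S \<noteq> {}" using psubset.prems by auto
      ultimately obtain v w where v: "v \<in> V - S" "w \<in> S" "(v, w) \<in> E"
        using conn[of S] psubset.prems by auto
      have ss: "S - E `` {v} \<subset> S" "S - E `` {v} \<subseteq> V" "S - E `` {v} \<noteq> V"
        using v psubset.prems by auto
      have "indep_poly E q (S - E `` {v}) \<noteq> 0" using psubset.IH[OF ss(1,2)] ss(3) by blast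
      then have "0 < q v * indep_poly E q (S - E `` {v})" using q[of v] v nn[OF ss(2)] by auto
      moreover have "indep_poly E q (insert v S) = indep_poly E q S - q v * indep_poly E q (S - E `` {v})"
        using psubset.hyps v sym irrefl by (intro indep_poly_insert) auto
      moreover have "0 \<le> indep_poly E q (insert v S)" using psubset.prems v by (intro nn) auto
      ultimately show False using psubset.prems by simp
    qed
  qed
qed

section \<open>The critical uniform probability\<close>

lemma continuous_on_indep_poly:
  "continuous_on A (\<lambda>x. indep_poly E (\<lambda>_. x) S)"
  unfolding indep_poly_def by (intro continuous_intros)

lemma continuous_on_Min:
  fixes f :: "'a \<Rightarrow> 'b :: topological_space \<Rightarrow> real"
  assumes "finite I" "I \<noteq> {}" "\<And>i. i \<in> I \<Longrightarrow> continuous_on A (f i)"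
  shows "continuous_on A (\<lambda>x. Min ((\<lambda>i. f i x) ` I))"
  using assms
proof (induction I rule: finite_ne_induct)
  case (insert i I)
  then have "continuous_on A (\<lambda>x. min (f i x) (Min ((\<lambda>i. f i x) ` I)))"
    by (intro continuous_on_min) auto
  then show ?case using insert by simp
qed simp

text \<open>The minimum of the polynomial over all vertex subsets is continuous in the probability,
  equals 1 at 0 and is at most 0 at 1. A zero of this minimum, unlike an arbitrary zero for
  \<open>V\<close>, keeps all subset values nonnegative, and connectedness then confines vanishing
  to \<open>V\<close>.\<close>

lemma ex_critical_probability:
  fixes E :: "'a rel"
  assumes fin: "finite V" and sym: "\<And>u v. (u, v) \<in> E \<Longrightarrow> (v, u) \<in> E" and irrefl: "\<And>v. (v, v) \<notin> E"
    and conn: "\<And>W. W \<subseteq> V \<Longrightarrow> W \<noteq> {} \<Longrightarrow> W \<noteq> V \<Longrightarrow> \<exists>v\<in>V - W. \<exists>w\<in>W. (v, w) \<in> E"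
    and edge: "u \<in> V" "w \<in> V" "(u, w) \<in> E"
  obtains p :: real where "0 < p" "p < 1" "indep_poly E (\<lambda>_. p) V = 0"
    "\<And>S. S \<subset> V \<Longrightarrow> 0 < indep_poly E (\<lambda>_. p) S"
proof -
  define m where "m = (\<lambda>x. Min ((\<lambda>S. indep_poly E (\<lambda>_. x) S) ` Pow V))"
  have m_le: "m x \<le> indep_poly E (\<lambda>_. x) S" if "S \<subseteq> V" for x S
    unfolding m_def using that fin by (intro Min_le) auto
  have single: "indep_poly E (\<lambda>_. x) {v} = 1 - x" for x v
    using indep_poly_insert[of "{}" v E "\<lambda>_. x"] sym irrefl by simp
  have "indep_poly E (\<lambda>_. 0) S = 1" if "S \<subseteq> V" for S
  proof -
    have "finite S" using that fin finite_subset by blast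
    then show ?thesis
      using sym irrefl by (induction S rule: finite_induct) (simp_all add: indep_poly_insert)
  qed
  then have "(\<lambda>S. indep_poly E (\<lambda>_. 0) S) ` Pow V = {1}" by auto
  then have m0: "m 0 = 1" by (simp add: m_def)
  have m1: "m 1 \<le> 0" using m_le[of "{u}" 1] edge single by simp
  have "continuous_on {0..1} m"
    unfolding m_def using fin by (intro continuous_on_Min continuous_on_indep_poly) auto
  then obtain p where p: "0 \<le> p" "p \<le> 1" "m p = 0"
    using IVT2'[of m 1 0 0] m0 m1 by auto
  have nn: "0 \<le> indep_poly E (\<lambda>_. p) S" if "S \<subseteq> V" for S using m_le[OF that, of p] p by simp
  have "p \<noteq> 0" using p m0 by auto
  have "u \<noteq> w" using irrefl edge by auto
  then have "indep_poly E (\<lambda>_. p) (insert w {u}) = indep_poly E (\<lambda>_. p) {u} - p * indep_poly E (\<lambda>_. p) ({u} - E `` {w})"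
    using sym irrefl by (intro indep_poly_insert) auto
  moreover have "{u} - E `` {w} = {}" using edge sym by auto
  \<comment> \<open>A single edge has polynomial \<open>1 - 2 * p\<close>, so \<open>p\<close> is at
    most one half.\<close>
  ultimately have "0 \<le> 1 - p - p" using nn[of "insert w {u}"] edge by (simp add: single)
  then have "p < 1" using p by simp
  have "0 < p" using p \<open>p \<noteq> 0\<close> by simp
  have "m p \<in> (\<lambda>S. indep_poly E (\<lambda>_. p) S) ` Pow V" unfolding m_def using fin by (intro Min_in) auto
  then obtain S where S: "S \<subseteq> V" "indep_poly E (\<lambda>_. p) S = 0" using p by auto
  have all: "S = V" if "S \<subseteq> V" "indep_poly E (\<lambda>_. p) S = 0" for S
    using indep_poly_first_zero[of V E "\<lambda>_. p" S] fin sym irrefl conn nn that \<open>0 < p\<close> by blast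
  show ?thesis
  proof (rule that[OF \<open>0 < p\<close> \<open>p < 1\<close>])
    show "indep_poly E (\<lambda>_. p) V = 0" using all[OF S] S by simp
    show "0 < indep_poly E (\<lambda>_. p) S" if "S \<subset> V" for S
      using all[of S] nn[of S] that by force
  qed
qed

section \<open>Shearer's measure\<close>

text \<open>Dropping the neighbours of \<open>v\<close> from the events to be avoided can only
  enlarge the part that \<open>v\<close> removes, and independence then factors it. The hypothesis
  \<open>ind\<close> is phrased so that dependency graphs and cubes both supply it.\<close>

lemma avoidance_of_independence:
  fixes A :: "'i \<Rightarrow> 'a set"
  assumes M: "prob_space M" and fin: "finite V"
    and sym: "\<And>u v. (u, v) \<in> E \<Longrightarrow> (v, u) \<in> E" and irrefl: "\<And>v. (v, v) \<notin> E"
    and A: "\<And>v. v \<in> V \<Longrightarrow> A v \<in> sets M" and pos: "\<And>v. v \<in> V \<Longrightarrow> 0 < measure M (A v)"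
    and ind: "\<And>v S. v \<in> V \<Longrightarrow> S \<subseteq> V - {v} - E `` {v} \<Longrightarrow>
      measure M (A v \<inter> (space M - (\<Union>u\<in>S. A u))) = measure M (A v) * measure M (space M - (\<Union>u\<in>S. A u))"
  shows "avoidance V E (\<lambda>v. measure M (A v)) (\<lambda>S. measure M (space M - (\<Union>u\<in>S. A u)))"
proof
  interpret prob_space M by (rule M)
  show "finite V" "\<And>u v. (u, v) \<in> E \<Longrightarrow> (v, u) \<in> E" "\<And>v. (v, v) \<notin> E"
    "\<And>v. v \<in> V \<Longrightarrow> 0 < measure M (A v)" by fact+
  show "measure M (space M - (\<Union>u\<in>{}. A u)) = 1" by (simp add: prob_space)
  show "0 \<le> measure M (space M - (\<Union>u\<in>S. A u))" for S by simp
  fix S v assume S: "S \<subseteq> V" and v: "v \<in> V - S"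
  have none: "space M - (\<Union>u\<in>T. A u) \<in> sets M" if "T \<subseteq> V" for T
    using that A finite_subset[OF that fin] by (intro sets.compl_sets sets.finite_UN) auto
  have "measure M (space M - (\<Union>u\<in>insert v S. A u)) =
      measure M ((space M - (\<Union>u\<in>S. A u)) - (A v \<inter> (space M - (\<Union>u\<in>S. A u))))"
    by (rule arg_cong[where f = "measure M"]) auto
  also have "\<dots> = measure M (space M - (\<Union>u\<in>S. A u)) - measure M (A v \<inter> (space M - (\<Union>u\<in>S. A u)))"
    using none[OF S] A[of v] v by (intro finite_measure_Diff) auto
  finally have eq: "measure M (space M - (\<Union>u\<in>insert v S. A u)) =
      measure M (space M - (\<Union>u\<in>S. A u)) - measure M (A v \<inter> (space M - (\<Union>u\<in>S. A u)))" .
  have "measure M (A v \<inter> (space M - (\<Union>u\<in>S. A u))) \<le>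
      measure M (A v \<inter> (space M - (\<Union>u\<in>S - E `` {v}. A u)))"
  proof (intro finite_measure_mono sets.Int)
    show "space M - (\<Union>u\<in>S - E `` {v}. A u) \<in> sets M" using S by (intro none) auto
  qed (use A v in auto)
  also have "\<dots> = measure M (A v) * measure M (space M - (\<Union>u\<in>S - E `` {v}. A u))"
    using S v by (intro ind) auto
  finally show "measure M (space M - (\<Union>u\<in>S. A u)) -
      measure M (A v) * measure M (space M - (\<Union>u\<in>S - E `` {v}. A u))
      \<le> measure M (space M - (\<Union>u\<in>insert v S. A u))"
    using eq by linarith
qed

text \<open>Inclusion-exclusion: once \<open>R\<close> is factored out, the sum expands the product
  of \<open>q i + - q i\<close> over \<open>U - R\<close>, which vanishes unless
  \<open>U - R\<close> is empty.\<close>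

lemma sum_supersets_alternating:
  fixes q :: "'a \<Rightarrow> real"
  assumes "finite U" "R \<subseteq> U"
  shows "(\<Sum>T | T \<subseteq> U \<and> R \<subseteq> T. (\<Prod>i\<in>T. q i) * (\<Prod>i\<in>U - T. - q i)) = (if U = R then (\<Prod>i\<in>R. q i) else 0)"
proof -
  have fR: "finite R" using assms finite_subset by blast
  have "(\<Sum>T | T \<subseteq> U \<and> R \<subseteq> T. (\<Prod>i\<in>T. q i) * (\<Prod>i\<in>U - T. - q i)) =
      (\<Sum>X\<in>Pow (U - R). (\<Prod>i\<in>R. q i) * ((\<Prod>i\<in>X. q i) * (\<Prod>i\<in>(U - R) - X. - q i)))"
  proof (rule sum.reindex_bij_witness[of _ "\<lambda>X. R \<union> X" "\<lambda>T. T - R"])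
    fix T assume T: "T \<in> {T. T \<subseteq> U \<and> R \<subseteq> T}"
    then have "T = R \<union> (T - R)" "finite (T - R)" using assms finite_subset by auto
    then have "(\<Prod>i\<in>T. q i) = (\<Prod>i\<in>R. q i) * (\<Prod>i\<in>T - R. q i)"
      using fR by (metis Diff_disjoint prod.union_disjoint)
    moreover have "U - R - (T - R) = U - T" using T by auto
    ultimately show "(\<Prod>i\<in>R. q i) * ((\<Prod>i\<in>T - R. q i) * (\<Prod>i\<in>U - R - (T - R). - q i)) =
      (\<Prod>i\<in>T. q i) * (\<Prod>i\<in>U - T. - q i)" by (simp add: mult.assoc)
  qed (use assms in auto)
  also have "\<dots> = (\<Prod>i\<in>R. q i) * (\<Prod>i\<in>U - R. q i + - q i)"
    using assms by (subst prod_add) (auto simp: sum_distrib_left)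
  also have "\<dots> = (if U = R then (\<Prod>i\<in>R. q i) else 0)"
    using assms by (auto simp: card_gt_0_iff)
  finally show ?thesis .
qed

text \<open>Outcomes are the sets of events that occur. Adjacent events are made disjoint, while the
  events of an independent set occur together with the product of their probabilities. Nonnegativity
  of \<open>Z\<close> on all subsets makes this a measure, and the empty outcome has mass
  \<open>Z q V\<close>.\<close>

lemma indep_poly_not_abstract_interior:
  fixes G :: "nat pair_pre_digraph"
  defines "V \<equiv> pverts G" and "Z \<equiv> indep_poly (parcs G)"
  assumes fin: "finite V" and sym: "\<And>u v. (u, v) \<in> parcs G \<Longrightarrow> (v, u) \<in> parcs G"
    and irrefl: "\<And>v. (v, v) \<notin> parcs G"
    and q: "\<And>v. v \<in> V \<Longrightarrow> 0 \<le> q v"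
    and zero: "Z q V = 0" and nn: "\<And>S. S \<subseteq> V \<Longrightarrow> 0 \<le> Z q S"
  shows "q \<notin> abstract_interior G"
proof
  assume q_int: "q \<in> abstract_interior G"
  define E where "E = parcs G"
  define I where "I = indep_in E"
  \<comment> \<open>The mass of the outcome in which exactly the events in \<open>T\<close> occur.
    Neighbours of \<open>T\<close> are excluded already, so inclusion-exclusion ranges over the
    independent sets of the remaining vertices.\<close>
  define w where "w = (\<lambda>T. if I T then (\<Prod>i\<in>T. q i) * Z q (V - T - E `` T) else 0)"
  define up where "up = (\<lambda>R. {T \<in> Pow V. R \<subseteq> T})"
  have w_nonneg: "0 \<le> w T" if "T \<subseteq> V" for T
    using that q by (auto simp: w_def intro!: mult_nonneg_nonneg prod_nonneg nn)
  have finS: "finite T" if "T \<subseteq> V" for T using that fin finite_subset by blast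
  have w_alt: "w T = (\<Sum>U | U \<in> {U \<in> Pow V. I U} \<and> T \<subseteq> U. (\<Prod>i\<in>T. q i) * (\<Prod>i\<in>U - T. - q i))"
    if T: "T \<subseteq> V" for T
  proof (cases "I T")
    case True
    have "(\<Sum>U | U \<in> {U \<in> Pow V. I U} \<and> T \<subseteq> U. (\<Prod>i\<in>T. q i) * (\<Prod>i\<in>U - T. - q i)) =
        (\<Sum>J\<in>{J \<in> Pow (V - T - E `` T). I J}. (\<Prod>i\<in>T. q i) * (\<Prod>i\<in>J. - q i))"
    proof (rule sum.reindex_bij_witness[of _ "\<lambda>J. T \<union> J" "\<lambda>U. U - T"])
      fix J assume J: "J \<in> {J \<in> Pow (V - T - E `` T). I J}"
      show "T \<union> J \<in> {U. U \<in> {U \<in> Pow V. I U} \<and> T \<subseteq> U}"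
        using J True T sym unfolding I_def indep_in_def E_def by blast
      show "T \<union> J - T = J" using J by auto
    qed (auto simp: I_def indep_in_def)
    then show ?thesis using True
      by (simp add: w_def Z_def indep_poly_def sum_distrib_left I_def E_def)
  next
    case False
    then have "{U. U \<in> {U \<in> Pow V. I U} \<and> T \<subseteq> U} = {}" by (auto simp: I_def indep_in_def)
    then show ?thesis using False unfolding w_def by (simp only: sum.empty if_False)
  qed
  have sum_up: "(\<Sum>T\<in>up R. w T) = (if I R then (\<Prod>i\<in>R. q i) else 0)" if R: "R \<subseteq> V" for R
  proof -
    have "(\<Sum>T\<in>up R. w T) =
        (\<Sum>T\<in>up R. \<Sum>U | U \<in> {U \<in> Pow V. I U} \<and> T \<subseteq> U. (\<Prod>i\<in>T. q i) * (\<Prod>i\<in>U - T. - q i))"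
      by (intro sum.cong refl w_alt) (auto simp: up_def)
    also have "\<dots> = (\<Sum>U\<in>{U \<in> Pow V. I U}. \<Sum>T | T \<in> up R \<and> T \<subseteq> U. (\<Prod>i\<in>T. q i) * (\<Prod>i\<in>U - T. - q i))"
      using fin by (intro sum.swap_restrict) (auto simp: up_def)
    also have "\<dots> = (\<Sum>U\<in>{U \<in> Pow V. I U}. if U = R then (\<Prod>i\<in>R. q i) else 0)"
    proof (intro sum.cong refl)
      fix U assume U: "U \<in> {U \<in> Pow V. I U}"
      show "(\<Sum>T | T \<in> up R \<and> T \<subseteq> U. (\<Prod>i\<in>T. q i) * (\<Prod>i\<in>U - T. - q i)) = (if U = R then (\<Prod>i\<in>R. q i) else 0)"
      proof (cases "R \<subseteq> U")
        case True
        have "{T. T \<in> up R \<and> T \<subseteq> U} = {T. T \<subseteq> U \<and> R \<subseteq> T}" using U by (auto simp: up_def)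
        then show ?thesis using sum_supersets_alternating[OF finS True] U by simp
      next
        case False
        then have "{T. T \<in> up R \<and> T \<subseteq> U} = {}" by (auto simp: up_def)
        moreover have "U \<noteq> R" using False by auto
          ultimately show ?thesis by (simp only: sum.empty if_False)
      qed
    qed
    also have "\<dots> = (if I R then (\<Prod>i\<in>R. q i) else 0)" using R fin by (simp add: sum.delta')
    finally show ?thesis .
  qed
  define N where "N = point_measure (Pow V) (\<lambda>T. ennreal (w T))"
  define B where "B = (\<lambda>i. up {i})"
  have spN: "space N = Pow V" and setsN: "sets N = Pow (Pow V)" by (simp_all add: N_def space_point_measure sets_point_measure)
  have eN: "emeasure N X = ennreal (\<Sum>T\<in>X. w T)" if "X \<subseteq> Pow V" for X
    unfolding N_def using that fin w_nonneg
    by (subst emeasure_point_measure_finite) (auto intro!: sum_ennreal)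
  have mN: "measure N X = (\<Sum>T\<in>X. w T)" if "X \<subseteq> Pow V" for X
    using eN[OF that] that w_nonneg by (subst measure_eq_emeasure_eq_ennreal) (auto intro!: sum_nonneg)
  have up_sub: "up R \<subseteq> Pow V" for R by (auto simp: up_def)
  have I_empty: "I {}" and I_single: "I {v}" for v using irrefl by (auto simp: I_def indep_in_def E_def)
  have "emeasure N (space N) = 1"
    using eN[of "Pow V"] sum_up[of "{}"] I_empty by (simp add: spN up_def Pow_def)
  then interpret N: prob_space N by (rule prob_spaceI)
  have "dependency_graph G N B"
    unfolding dependency_graph_def
  proof
    fix i assume i: "i \<in> pverts G"
    define J where "J = {j \<in> pverts G. j \<noteq> i \<and> (i, j) \<notin> parcs G}"
    have upsets: "up R \<in> sets N" for R using up_sub by (simp add: setsN)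
    \<comment> \<open>The events \<open>up R\<close> form a pi-system whose generated sigma-algebra
      contains all events of non-neighbours. On it independence is visible: as \<open>i\<close> has
      no neighbour in \<open>J\<close>, adding \<open>i\<close> to \<open>R\<close> does not change
      whether \<open>R\<close> is independent.\<close>
    have "N.indep_set {B i} (up ` Pow J)"
      unfolding N.indep_sets2_eq
    proof (intro conjI ballI)
      fix a b assume a: "a \<in> {B i}" and b: "b \<in> up ` Pow J"
      then obtain R where R: "R \<subseteq> J" "b = up R" by auto
      have RV: "R \<subseteq> V" "insert i R \<subseteq> V" "i \<notin> R" using R i by (auto simp: J_def V_def)
      have "a \<inter> b = up (insert i R)" using a R by (auto simp: B_def up_def)
      moreover have "I (insert i R) \<longleftrightarrow> I R"
        using R sym irrefl by (auto simp: I_def indep_in_def E_def J_def)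
      ultimately show "N.prob (a \<inter> b) = N.prob a * N.prob b"
        using a R RV mN[OF up_sub] sum_up[of "{i}"] sum_up[of R] sum_up[of "insert i R"] I_single finS[of R]
        by (auto simp: B_def)
    qed (auto simp: B_def upsets)
    moreover have "Int_stable (up ` Pow J)"
    proof (rule Int_stableI)
      fix a b assume "a \<in> up ` Pow J" "b \<in> up ` Pow J"
      then obtain R S where "R \<subseteq> J" "S \<subseteq> J" "a = up R" "b = up S" by auto
      moreover have "up R \<inter> up S = up (R \<union> S)" by (auto simp: up_def)
      ultimately show "a \<inter> b \<in> up ` Pow J" by auto
    qed
    moreover have "Int_stable {B i}" by (auto simp: Int_stable_def)
    ultimately have "N.indep_set (sigma_sets (space N) {B i}) (sigma_sets (space N) (up ` Pow J))"
      by (intro N.indep_set_sigma_sets)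
    moreover have "sigma_sets (space N) (B ` J) \<subseteq> sigma_sets (space N) (up ` Pow J)"
      by (intro sigma_sets_mono') (auto simp: B_def)
    moreover have "B i \<in> sigma_sets (space N) {B i}" by auto
    ultimately show "N.indep_set {B i} (sigma_sets (space N) (B ` {j \<in> pverts G. j \<noteq> i \<and> (i, j) \<notin> parcs G}))"
      unfolding N.indep_sets2_eq J_def by blast
  qed
  moreover have "B \<in> pverts G \<rightarrow> sets N" using up_sub by (auto simp: B_def setsN)
  moreover have "\<forall>i\<in>pverts G. measure N (B i) = q i"
    using mN[OF up_sub] sum_up I_single by (simp add: B_def V_def)
  ultimately have "0 < measure N (space N \<inter> (\<Inter>i\<in>pverts G. space N - B i))"
    using q_int N.prob_space_axioms unfolding abstract_interior_def by blast
  also have "space N \<inter> (\<Inter>i\<in>pverts G. space N - B i) = {{}}"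
    by (auto simp: spN B_def up_def V_def)
  also have "measure N {{}} = 0" using mN[of "{{}}"] zero I_empty by (simp add: w_def)
  finally show False by simp
qed

section \<open>Events depending on few coordinates\<close>

text \<open>A pointwise form of the cylinder condition that names no base set, so that unions and
  complements stay within one product space.\<close>

definition depends_on :: "'i set \<Rightarrow> ('i \<Rightarrow> 'a) set \<Rightarrow> ('i \<Rightarrow> 'a) set \<Rightarrow> bool" where
  "depends_on K \<Omega> A \<longleftrightarrow> (\<forall>x\<in>\<Omega>. \<forall>y\<in>\<Omega>. (\<forall>k\<in>K. x k = y k) \<longrightarrow> (x \<in> A \<longleftrightarrow> y \<in> A))"

lemma depends_onD:
  "depends_on K \<Omega> A \<Longrightarrow> x \<in> \<Omega> \<Longrightarrow> y \<in> \<Omega> \<Longrightarrow> (\<And>k. k \<in> K \<Longrightarrow> x k = y k) \<Longrightarrow> x \<in> A \<longleftrightarrow> y \<in> A"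
  unfolding depends_on_def by blast

lemma depends_on_prod_emb: "K \<subseteq> I \<Longrightarrow> depends_on K (space (PiM I M)) (prod_emb I M K B)"
  unfolding depends_on_def
proof (intro ballI impI)
  fix x y assume "x \<in> space (PiM I M)" "y \<in> space (PiM I M)" and eq: "\<forall>k\<in>K. x k = y k"
  moreover have "restrict x K = restrict y K" using eq by (auto simp: restrict_def)
  ultimately show "x \<in> prod_emb I M K B \<longleftrightarrow> y \<in> prod_emb I M K B"
    by (auto simp: prod_emb_iff space_PiM PiE_iff)
qed

lemma depends_on_Diff_UN:
  "(\<And>u. u \<in> S \<Longrightarrow> depends_on (K u) \<Omega> (A u)) \<Longrightarrow> depends_on (\<Union>u\<in>S. K u) \<Omega> (\<Omega> - (\<Union>u\<in>S. A u))"
proof -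
  assume A: "\<And>u. u \<in> S \<Longrightarrow> depends_on (K u) \<Omega> (A u)"
  have "x \<in> A u \<longleftrightarrow> y \<in> A u" if "x \<in> \<Omega>" "y \<in> \<Omega>" "\<forall>k\<in>\<Union>u\<in>S. K u. x k = y k" "u \<in> S" for x y u
    using that by (intro depends_onD[OF A]) auto
  then show ?thesis unfolding depends_on_def by blast
qed

context product_sigma_finite
begin

context
  assumes prob: "\<And>i. prob_space (M i)"
begin

lemma prob_space_PiM': "prob_space (PiM I M)"
  using prob by (intro prob_space_PiM)

text \<open>The base is the section of \<open>A\<close> at a fixed point \<open>x0\<close> for the
  coordinates outside \<open>K\<close>; dependence on \<open>K\<close> makes the choice of
  \<open>x0\<close> immaterial.\<close>

lemma depends_on_imp_prod_emb:
  assumes A: "A \<in> sets (PiM I M)" "depends_on K (space (PiM I M)) A" and K: "K \<subseteq> I"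
  shows "\<exists>B\<in>sets (PiM K M). A = prod_emb I M K B"
proof -
  obtain x0 where x0: "x0 \<in> space (PiM (I - K) M)"
    using prob_space.not_empty[OF prob_space_PiM'[of "I - K"]] by blast
  have IK: "K \<union> (I - K) = I" using K by auto
  define B where "B = (\<lambda>y. merge K (I - K) (y, x0)) -` A \<inter> space (PiM K M)"
  have "(\<lambda>y. merge K (I - K) (y, x0)) \<in> measurable (PiM K M) (PiM (K \<union> (I - K)) M)"
    using x0 by measurable
  then have "B \<in> sets (PiM K M)" unfolding B_def IK using A(1) by (rule measurable_sets)
  moreover have "A = prod_emb I M K B"
  proof (intro set_eqI)
    fix x
    show "x \<in> A \<longleftrightarrow> x \<in> prod_emb I M K B"
    proof (cases "x \<in> space (PiM I M)")
      case True
      then have r: "restrict x K \<in> space (PiM K M)" using K by (auto simp: space_PiM PiE_iff)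
      have "merge K (I - K) (restrict x K, x0) \<in> space (PiM (K \<union> (I - K)) M)"
        using r x0 by (auto simp: space_PiM PiE_iff merge_def extensional_def)
      then have "x \<in> A \<longleftrightarrow> merge K (I - K) (restrict x K, x0) \<in> A"
        using True unfolding IK by (intro depends_onD[OF A(2)]) (auto simp: merge_def)
      also have "\<dots> \<longleftrightarrow> x \<in> prod_emb I M K B"
        using True r by (auto simp: prod_emb_iff B_def space_PiM PiE_iff)
      finally show ?thesis .
    next
      case False
      then show ?thesis using sets.sets_into_space[OF A(1)] by (auto simp: prod_emb_iff space_PiM PiE_iff)
    qed
  qed
  ultimately show ?thesis by blast
qed

lemma emeasure_Int_depends_on:
  assumes I: "finite I" and A: "A \<in> sets (PiM I M)" "depends_on K (space (PiM I M)) A"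
    and B: "B \<in> sets (PiM I M)" "depends_on L (space (PiM I M)) B" and KL: "K \<inter> L = {}"
  shows "emeasure (PiM I M) (A \<inter> B) = emeasure (PiM I M) A * emeasure (PiM I M) B"
proof -
  define I1 where "I1 = I \<inter> K"
  define I2 where "I2 = I - K"
  have I12: "I1 \<union> I2 = I" "I1 \<inter> I2 = {}" "finite I1" "finite I2" using I by (auto simp: I1_def I2_def)
  interpret P: prob_space "PiM I M" by (rule prob_space_PiM')
  interpret P1: prob_space "PiM I1 M" by (rule prob_space_PiM')
  interpret P2: prob_space "PiM I2 M" by (rule prob_space_PiM')
  obtain x0 where x0: "x0 \<in> space (PiM I1 M)" using P1.not_empty by blast
  obtain y0 where y0: "y0 \<in> space (PiM I2 M)" using P2.not_empty by blast
  have mg: "merge I1 I2 (x, y) \<in> space (PiM I M)" if "x \<in> space (PiM I1 M)" "y \<in> space (PiM I2 M)" for x y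
    using that I12 by (auto simp: space_PiM PiE_iff merge_def extensional_def)
  have mm: "(\<lambda>x. merge I1 I2 (x, y)) \<in> measurable (PiM I1 M) (PiM I M)" if "y \<in> space (PiM I2 M)" for y
    using that measurable_compose[OF measurable_Pair measurable_merge[of I1 I2 M], of "\<lambda>x. x" _ "\<lambda>x. y"] I12 by simp
  have mm': "(\<lambda>y. merge I1 I2 (x, y)) \<in> measurable (PiM I2 M) (PiM I M)" if "x \<in> space (PiM I1 M)" for x
    using that measurable_compose[OF measurable_Pair measurable_merge[of I1 I2 M], of "\<lambda>_. x" _ "\<lambda>x. x"] I12 by simp
  define a where "a = (\<lambda>A. \<integral>\<^sup>+x. indicator A (merge I1 I2 (x, y0)) \<partial>PiM I1 M)"
  define b where "b = (\<lambda>B. \<integral>\<^sup>+y. indicator B (merge I1 I2 (x0, y)) \<partial>PiM I2 M)"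
  \<comment> \<open>Freezing the coordinates on which an event does not depend splits the double
    integral into two factors. The statement covers arbitrary events so that one of them may be the
    whole space, which identifies the factors as the measures of \<open>A\<close> and
    \<open>B\<close>.\<close>
  have key: "emeasure (PiM I M) (A \<inter> B) = a A * b B"
    if A: "A \<in> sets (PiM I M)" "depends_on K (space (PiM I M)) A"
      and B: "B \<in> sets (PiM I M)" "depends_on L (space (PiM I M)) B" for A B
  proof -
    have AI: "indicator A (merge I1 I2 (x, y)) = (indicator A (merge I1 I2 (x, y0)) :: ennreal)"
      if xy: "x \<in> space (PiM I1 M)" "y \<in> space (PiM I2 M)" for x y
    proof -
      have "merge I1 I2 (x, y) \<in> A \<longleftrightarrow> merge I1 I2 (x, y0) \<in> A"
        using xy y0 by (intro depends_onD[OF A(2)] mg) (auto simp: merge_def I1_def I2_def)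
      then show ?thesis by (simp add: indicator_def)
    qed
    have BI: "indicator B (merge I1 I2 (x, y)) = (indicator B (merge I1 I2 (x0, y)) :: ennreal)"
      if xy: "x \<in> space (PiM I1 M)" "y \<in> space (PiM I2 M)" for x y
    proof -
      have "merge I1 I2 (x, y) \<in> B \<longleftrightarrow> merge I1 I2 (x0, y) \<in> B"
        using xy x0 KL by (intro depends_onD[OF B(2)] mg) (auto simp: merge_def I1_def I2_def)
      then show ?thesis by (simp add: indicator_def)
    qed
    have m1: "(\<lambda>x. indicator A (merge I1 I2 (x, y0)) :: ennreal) \<in> borel_measurable (PiM I1 M)"
      using measurable_compose[OF mm[OF y0] borel_measurable_indicator[OF A(1)]] .
    have m2: "(\<lambda>y. indicator B (merge I1 I2 (x0, y)) :: ennreal) \<in> borel_measurable (PiM I2 M)"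
      using measurable_compose[OF mm'[OF x0] borel_measurable_indicator[OF B(1)]] .
    have "emeasure (PiM I M) (A \<inter> B) = (\<integral>\<^sup>+z. indicator A z * indicator B z \<partial>PiM (I1 \<union> I2) M)"
      using A B I12 by (simp add: indicator_inter_arith[symmetric])
    also have "\<dots> = (\<integral>\<^sup>+x. \<integral>\<^sup>+y. indicator A (merge I1 I2 (x, y)) * indicator B (merge I1 I2 (x, y)) \<partial>PiM I2 M \<partial>PiM I1 M)"
      using A B I12 by (intro product_nn_integral_fold) auto
    also have "\<dots> = (\<integral>\<^sup>+x. \<integral>\<^sup>+y. indicator A (merge I1 I2 (x, y0)) * indicator B (merge I1 I2 (x0, y)) \<partial>PiM I2 M \<partial>PiM I1 M)"
      by (intro nn_integral_cong) (simp add: AI BI)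
    also have "\<dots> = (\<integral>\<^sup>+x. indicator A (merge I1 I2 (x, y0)) * b B \<partial>PiM I1 M)"
      unfolding b_def using m2 by (intro nn_integral_cong nn_integral_cmult)
    also have "\<dots> = a A * b B" unfolding a_def using m1 by (rule nn_integral_multc)
    finally show ?thesis .
  qed
  have top: "space (PiM I M) \<in> sets (PiM I M)" "depends_on J (space (PiM I M)) (space (PiM I M))" for J
    by (auto simp: depends_on_def)
  have "a (space (PiM I M)) = (\<integral>\<^sup>+x. 1 \<partial>PiM I1 M)"
    unfolding a_def using mg y0 by (intro nn_integral_cong) simp
  moreover have "b (space (PiM I M)) = (\<integral>\<^sup>+y. 1 \<partial>PiM I2 M)"
    unfolding b_def using mg x0 by (intro nn_integral_cong) simp
  ultimately have "a (space (PiM I M)) = 1" "b (space (PiM I M)) = 1"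
    by (simp_all add: P1.emeasure_space_1 P2.emeasure_space_1)
  then have "emeasure (PiM I M) A = a A" "emeasure (PiM I M) B = b B"
    using key[OF A top] key[OF top B] A(1) B(1) by simp_all
  then show ?thesis using key[OF A B] by simp
qed

text \<open>Conditionally on the shared coordinate the two events are independent, so almost surely one of
  the two conditional probabilities vanishes.\<close>
lemma null_Int_separated:
  assumes I: "finite I" "e \<in> I" and A: "A \<in> sets (PiM I M)" "depends_on K (space (PiM I M)) A"
    and B: "B \<in> sets (PiM I M)" "depends_on L (space (PiM I M)) B" and KL: "K \<inter> L \<subseteq> {e}"
    and null: "emeasure (PiM I M) (A \<inter> B) = 0"
  shows "\<exists>X\<in>sets (M e). emeasure (PiM I M) {x \<in> A. x e \<notin> X} = 0 \<and> emeasure (PiM I M) {x \<in> B. x e \<in> X} = 0"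
proof -
  define J where "J = I - {e}"
  have J: "insert e J = I" "e \<notin> J" "finite J" using I by (auto simp: J_def)
  interpret PJ: prob_space "PiM J M" by (rule prob_space_PiM')
  \<comment> \<open>\<open>h A y\<close> is the conditional probability of \<open>A\<close> given
    the value \<open>y\<close> of coordinate \<open>e\<close>.\<close>
  define h where "h = (\<lambda>A y. \<integral>\<^sup>+x. indicator A (x(e := y)) \<partial>PiM J M :: ennreal)"
  have upd: "(\<lambda>(y, x). x(e := y)) \<in> measurable (M e \<Otimes>\<^sub>M PiM J M) (PiM I M)"
    using measurable_compose[OF measurable_pair_swap' measurable_add_dim[where I = J and M = M and i = e]] J
    by (simp add: case_prod_unfold)
  have upd1: "(\<lambda>x. x(e := y)) \<in> measurable (PiM J M) (PiM I M)" if "y \<in> space (M e)" for y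
    using measurable_compose[OF measurable_Pair upd, of "\<lambda>_. y" _ "\<lambda>x. x"] that by simp
  have h_meas: "h A \<in> borel_measurable (M e)" if "A \<in> sets (PiM I M)" for A
    unfolding h_def
    using measurable_compose[OF upd borel_measurable_indicator[OF that]]
    by (intro PJ.borel_measurable_nn_integral) (simp add: case_prod_unfold)
  have fubini: "(\<integral>\<^sup>+z. f z \<partial>PiM I M) = (\<integral>\<^sup>+y. \<integral>\<^sup>+x. f (x(e := y)) \<partial>PiM J M \<partial>M e)"
    if "f \<in> borel_measurable (PiM I M)" for f
    using product_nn_integral_insert_rev[of J e f] J that by simp
  have sec: "emeasure (PiM I M) {x \<in> A. x e \<in> Y} = (\<integral>\<^sup>+y. h A y * indicator Y y \<partial>M e)"
    if AY: "A \<in> sets (PiM I M)" "Y \<in> sets (M e)" for A Y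
  proof -
    have eq: "{x \<in> A. x e \<in> Y} = A \<inter> {x \<in> space (PiM I M). x e \<in> Y}"
      using sets.sets_into_space[OF AY(1)] by auto
    have Ym: "{x \<in> space (PiM I M). x e \<in> Y} \<in> sets (PiM I M)" using AY I by measurable
    have "emeasure (PiM I M) {x \<in> A. x e \<in> Y} = (\<integral>\<^sup>+z. indicator A z * indicator {x \<in> space (PiM I M). x e \<in> Y} z \<partial>PiM I M)"
      unfolding eq using AY Ym by (simp add: indicator_inter_arith[symmetric])
    also have "\<dots> = (\<integral>\<^sup>+y. \<integral>\<^sup>+x. indicator A (x(e := y)) * indicator {x \<in> space (PiM I M). x e \<in> Y} (x(e := y)) \<partial>PiM J M \<partial>M e)"
      using AY Ym by (intro fubini) auto
    also have "\<dots> = (\<integral>\<^sup>+y. \<integral>\<^sup>+x. indicator A (x(e := y)) * indicator Y y \<partial>PiM J M \<partial>M e)"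
    proof (intro nn_integral_cong)
      fix y x assume "y \<in> space (M e)" "x \<in> space (PiM J M)"
      then have "x(e := y) \<in> space (PiM I M)" using measurable_space[OF upd1] by blast
      then show "indicator A (x(e := y)) * indicator {x \<in> space (PiM I M). x e \<in> Y} (x(e := y)) = (indicator A (x(e := y)) * indicator Y y :: ennreal)"
        by (simp add: indicator_def)
    qed
    also have "\<dots> = (\<integral>\<^sup>+y. h A y * indicator Y y \<partial>M e)"
      unfolding h_def using measurable_compose[OF upd1 borel_measurable_indicator[OF AY(1)]]
      by (intro nn_integral_cong nn_integral_multc)
    finally show ?thesis .
  qed
  have prod: "(\<integral>\<^sup>+x. indicator (A \<inter> B) (x(e := y)) \<partial>PiM J M) = h A y * h B y" if y: "y \<in> space (M e)" for y
  proof -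
    have 1: "(\<lambda>x. x(e := y)) -` C \<inter> space (PiM J M) \<in> sets (PiM J M)" if "C \<in> sets (PiM I M)" for C
      using measurable_sets[OF upd1[OF y] that] .
    have 2: "(\<integral>\<^sup>+x. indicator C (x(e := y)) \<partial>PiM J M) = emeasure (PiM J M) ((\<lambda>x. x(e := y)) -` C \<inter> space (PiM J M))"
      if "C \<in> sets (PiM I M)" for C
    proof -
      have "(\<integral>\<^sup>+x. indicator C (x(e := y)) \<partial>PiM J M) = (\<integral>\<^sup>+x. indicator ((\<lambda>x. x(e := y)) -` C \<inter> space (PiM J M)) x \<partial>PiM J M)"
        by (intro nn_integral_cong) (simp add: indicator_def)
      then show ?thesis using 1[OF that] by simp
    qed
    have 3: "depends_on (K - {e}) (space (PiM J M)) ((\<lambda>x. x(e := y)) -` C \<inter> space (PiM J M))"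
      if C: "depends_on K (space (PiM I M)) C" for C K
      unfolding depends_on_def
    proof (intro ballI impI)
      fix x x' assume x: "x \<in> space (PiM J M)" "x' \<in> space (PiM J M)" "\<forall>k\<in>K - {e}. x k = x' k"
      have "x(e := y) \<in> C \<longleftrightarrow> x'(e := y) \<in> C"
        using x measurable_space[OF upd1[OF y]] by (intro depends_onD[OF C]) auto
      then show "x \<in> (\<lambda>x. x(e := y)) -` C \<inter> space (PiM J M) \<longleftrightarrow> x' \<in> (\<lambda>x. x(e := y)) -` C \<inter> space (PiM J M)"
        using x by simp
    qed
    define S where "S = (\<lambda>C. (\<lambda>x. x(e := y)) -` C \<inter> space (PiM J M))"
    have "emeasure (PiM J M) (S A \<inter> S B) = emeasure (PiM J M) (S A) * emeasure (PiM J M) (S B)"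
      unfolding S_def using KL
      by (intro emeasure_Int_depends_on[OF J(3) 1[OF A(1)] 3[OF A(2)] 1[OF B(1)] 3[OF B(2)]]) auto
    moreover have "S (A \<inter> B) = S A \<inter> S B" by (auto simp: S_def)
    ultimately show ?thesis
      unfolding h_def using 2[OF A(1)] 2[OF B(1)] 2[OF sets.Int[OF A(1) B(1)]] by (simp add: S_def)
  qed
  have hh: "AE y in M e. h A y * h B y = 0"
  proof -
    have AB: "A \<inter> B \<in> sets (PiM I M)" using A B by auto
    have "(\<integral>\<^sup>+y. h A y * h B y \<partial>M e) = (\<integral>\<^sup>+y. \<integral>\<^sup>+x. indicator (A \<inter> B) (x(e := y)) \<partial>PiM J M \<partial>M e)"
      by (intro nn_integral_cong) (simp only: prod)
    also have "\<dots> = emeasure (PiM I M) (A \<inter> B)"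
      using fubini[of "indicator (A \<inter> B)"] AB by simp
    finally have "(\<integral>\<^sup>+y. h A y * h B y \<partial>M e) = 0" using null by simp
    moreover have "(\<lambda>y. h A y * h B y) \<in> borel_measurable (M e)" using h_meas A(1) B(1) by measurable
    ultimately show ?thesis by (simp add: nn_integral_0_iff_AE)
  qed
  \<comment> \<open>On the values where \<open>A\<close> has positive conditional probability,
    \<open>B\<close> almost surely has none, because the product of the two vanishes.\<close>
  define X where "X = {y \<in> space (M e). h A y \<noteq> 0}"
  have X: "X \<in> sets (M e)" unfolding X_def using h_meas[OF A(1)] by measurable
  have "{x \<in> A. x e \<notin> X} = {x \<in> A. x e \<in> space (M e) - X}"
    using sets.sets_into_space[OF A(1)] I by (auto simp: space_PiM PiE_iff)
  also have "emeasure (PiM I M) \<dots> = (\<integral>\<^sup>+y. 0 \<partial>M e)"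
    using sec[OF A(1), of "space (M e) - X"] X
    by (simp del: nn_integral_const) (auto intro!: nn_integral_cong simp: X_def indicator_def simp del: nn_integral_const)
  finally have "emeasure (PiM I M) {x \<in> A. x e \<notin> X} = 0" by simp
  moreover have "emeasure (PiM I M) {x \<in> B. x e \<in> X} = (\<integral>\<^sup>+y. 0 \<partial>M e)"
    unfolding sec[OF B(1) X] using hh by (intro nn_integral_cong_AE) (auto simp: X_def indicator_def)
  ultimately show ?thesis using X by (intro bexI[of _ X]) auto
qed

end

end

section \<open>The Lebesgue cube\<close>

abbreviation unit_interval :: "real measure" where
  "unit_interval \<equiv> restrict_space lborel {0..1}"

lemma space_unit_interval: "space unit_interval = {0..1}"
  by (simp add: space_restrict_space)

lemma prob_space_unit_interval: "prob_space unit_interval"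
  by (rule prob_spaceI) (simp add: space_restrict_space emeasure_restrict_space)

interpretation unit_interval: prob_space unit_interval
  by (rule prob_space_unit_interval)

interpretation cube: product_sigma_finite "\<lambda>_ :: nat. unit_interval"
  by unfold_locales

lemma prob_space_cube: "prob_space (PiM I (\<lambda>_ :: nat. unit_interval))"
  by (intro prob_space_PiM prob_space_unit_interval)

lemma measure_unit_interval_atLeastLessThan:
  assumes "0 \<le> a" "a \<le> b" "b \<le> 1"
  shows "measure unit_interval {a..<b} = b - a"
  using assms by (subst measure_restrict_space) auto

lemma sets_unit_interval_iff: "S \<in> sets unit_interval \<longleftrightarrow> S \<subseteq> {0..1} \<and> S \<in> sets borel"
  by (simp add: sets_restrict_space_iff)

lemma measure_cube_box:
  fixes j :: "'i \<Rightarrow> nat"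
  assumes C: "finite C" "inj_on j C" "j ` C \<subseteq> I" and S: "\<And>c. c \<in> C \<Longrightarrow> S c \<in> sets unit_interval"
  shows "measure (PiM I (\<lambda>_. unit_interval)) {x \<in> space (PiM I (\<lambda>_. unit_interval)). \<forall>c\<in>C. x (j c) \<in> S c}
    = (\<Prod>c\<in>C. measure unit_interval (S c))"
proof -
  interpret P: product_prob_space "\<lambda>_ :: nat. unit_interval" I
    by (intro product_prob_spaceI prob_space_unit_interval)
  define g where "g = (\<lambda>k. S (the_inv_into C j k))"
  have g: "g (j c) = S c" if "c \<in> C" for c
    using that C(2) by (simp add: g_def the_inv_into_f_f)
  have "emeasure (PiM I (\<lambda>_. unit_interval)) {x \<in> space (PiM I (\<lambda>_. unit_interval)). \<forall>k\<in>j ` C. x k \<in> g k}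
    = (\<Prod>k\<in>j ` C. emeasure unit_interval (g k))"
    using C S by (intro P.emeasure_PiM_Collect) (auto simp: g)
  also have "\<dots> = (\<Prod>c\<in>C. emeasure unit_interval (S c))"
    using C(2) by (simp add: prod.reindex g)
  also have "\<dots> = ennreal (\<Prod>c\<in>C. measure unit_interval (S c))"
    by (simp add: unit_interval.emeasure_eq_measure prod_ennreal)
  finally show ?thesis
    by (subst measure_eq_emeasure_eq_ennreal) (auto simp: g prod_nonneg)
qed

text \<open>The interior prescribes probabilities exactly, while coverings are easier to build with
  upper bounds. Adding a slab in a coordinate already seen raises the measure continuously to 1 and
  creates no new dependence.\<close>

lemma enlarge_to_measure:
  fixes I :: "nat set"
  defines "P \<equiv> PiM I (\<lambda>_. unit_interval)"
  assumes A: "A \<in> sets P" "depends_on K (space P) A" and j: "j \<in> K" "j \<in> I"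
    and q: "measure P A \<le> q" "q \<le> 1"
  shows "\<exists>B\<in>sets P. A \<subseteq> B \<and> depends_on K (space P) B \<and> measure P B = q"
proof -
  interpret P: prob_space P unfolding P_def by (rule prob_space_cube)
  have range: "x j \<in> {0..1}" if "x \<in> space P" for x
    using that j by (auto simp: P_def space_PiM space_unit_interval PiE_iff)
  define H where "H = (\<lambda>s. {x \<in> space P. x j \<in> {0..s}})"
  have slab: "{x \<in> space P. x j \<in> S} \<in> sets P" if "S \<in> sets borel" for S
  proof -
    have "(\<lambda>x. x j) \<in> measurable P unit_interval" unfolding P_def by (rule measurable_component_singleton[OF j(2)])
    then have "(\<lambda>x. x j) \<in> borel_measurable P"
      by (rule measurable_compose) (simp add: measurable_restrict_space1)
    then show ?thesis using that by measurable
  qed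
  have H: "H s \<in> sets P" for s unfolding H_def by (intro slab) simp
  define g where "g = (\<lambda>s. measure P (A \<union> H s))"
  have lip: "\<bar>g s - g t\<bar> \<le> \<bar>s - t\<bar>" if "s \<in> {-1..1}" "t \<in> {-1..1}" for s t
  proof -
    have *: "g b - g a \<le> b - a \<and> g a \<le> g b" if "-1 \<le> a" "a \<le> b" "b \<le> 1" for a b
    proof
      define D where "D = {x \<in> space P. x j \<in> {a<..b} \<inter> {0..1}}"
      have D: "D \<in> sets P" unfolding D_def by (intro slab) simp
      have "A \<union> H b \<subseteq> (A \<union> H a) \<union> D" using range by (auto simp: H_def D_def)
      then have "g b \<le> measure P ((A \<union> H a) \<union> D)"
        unfolding g_def using A H D by (intro P.finite_measure_mono) auto
      also have "\<dots> \<le> g a + measure P D" unfolding g_def using A H D by (intro measure_Un_le) auto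
      also have "measure P D = measure unit_interval ({a<..b} \<inter> {0..1})"
        using measure_cube_box[of "{j}" "\<lambda>c. c" I "\<lambda>_. {a<..b} \<inter> {0..1}"] j
        by (simp add: D_def P_def sets_unit_interval_iff)
      also have "\<dots> = measure lborel ({a<..b} \<inter> {0..1})" by (subst measure_restrict_space) auto
      also have "\<dots> \<le> measure lborel {a<..b}"
        using that by (intro measure_mono_fmeasurable) (auto simp: fmeasurable_def)
      also have "\<dots> = b - a" using that by simp
      finally show "g b - g a \<le> b - a" by simp
      show "g a \<le> g b" unfolding g_def using A H that by (intro P.finite_measure_mono) (auto simp: H_def)
    qed
    show ?thesis using *[of s t] *[of t s] that by (cases "s \<le> t") auto
  qed
  have "continuous_on {-1..1} g"
  proof (rule continuous_onI)
    fix s e :: real assume s: "s \<in> {-1..1}" and e: "0 < e"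
    show "\<exists>d>0. \<forall>t\<in>{-1..1}. dist t s < d \<longrightarrow> dist (g t) (g s) \<le> e"
    proof (intro exI conjI ballI impI)
      fix t assume "t \<in> {-1..1}" "dist t s < e"
      then show "dist (g t) (g s) \<le> e" using lip[of t s] s by (simp add: dist_real_def)
    qed (rule e)
  qed
  \<comment> \<open>The parameter starts at -1 because the slab is empty there, whereas at 0 it is a
    nonempty null set.\<close>
  moreover have "g (-1) \<le> q"
  proof -
    have "H (-1) = {}" by (auto simp: H_def)
    then show ?thesis using q by (simp add: g_def)
  qed
  moreover have "q \<le> g 1"
  proof -
    have "A \<union> H 1 = space P" using range sets.sets_into_space[OF A(1)] by (auto simp: H_def)
    then show ?thesis using q P.prob_space by (simp add: g_def)
  qed
  ultimately obtain s where s: "g s = q" using IVT'[of g "-1" q 1] by auto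
  have "depends_on K (space P) (A \<union> H s)"
    unfolding depends_on_def
  proof (intro ballI impI)
    fix x y assume xy: "x \<in> space P" "y \<in> space P" "\<forall>k\<in>K. x k = y k"
    then have "x \<in> A \<longleftrightarrow> y \<in> A" by (intro depends_onD[OF A(2)]) auto
    moreover have "x j = y j" using xy j by auto
    ultimately show "x \<in> A \<union> H s \<longleftrightarrow> y \<in> A \<union> H s" using xy by (simp add: H_def)
  qed
  then show ?thesis using A H s by (intro bexI[of _ "A \<union> H s"]) (auto simp: g_def)
qed

text \<open>Passing to Borel sets: a Lebesgue measurable base differs from a Borel one by a null set,
  and the cylinder over a null set is null.\<close>
lemma bigraph_interior_borel:
  assumes H: "is_bigraph H"
  defines "P \<equiv> PiM {1..nright H} (\<lambda>_. unit_interval)"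
  shows "p \<in> bigraph_interior H \<longleftrightarrow>
    p \<in> {1..nleft H} \<rightarrow> {0<..<1} \<and>
    (\<forall>A. (\<forall>i\<in>{1..nleft H}. A i \<in> sets P \<and> depends_on (left_nbrs H i) (space P) (A i) \<and> measure P (A i) = p i)
      \<longrightarrow> 0 < measure P (space P - (\<Union>i\<in>{1..nleft H}. A i)))"
    (is "_ \<longleftrightarrow> ?R")
proof
  let ?V = "{1..nleft H}" and ?J = "{1..nright H}" and ?N = "left_nbrs H"
  let ?U = "\<lambda>_ :: nat. unit_interval"
  have NJ: "?N i \<subseteq> ?J" for i using H by (auto simp: is_bigraph_def left_nbrs_def)
  have cube: "cube ?J = completion P" by (simp add: cube_def P_def)
  interpret P: prob_space P unfolding P_def by (rule prob_space_cube)
  have none: "space P \<inter> (\<Inter>i\<in>?V. space P - A i) = space P - (\<Union>i\<in>?V. A i)" for A by auto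
  have sets_none: "space P - (\<Union>i\<in>?V. A i) \<in> sets P" if "\<And>i. i \<in> ?V \<Longrightarrow> A i \<in> sets P" for A
    using that by auto
  {
    assume p: "p \<in> bigraph_interior H"
    show ?R
    proof (intro conjI allI impI)
      show "p \<in> ?V \<rightarrow> {0<..<1}" using p by (simp add: bigraph_interior_def)
      fix A assume A: "\<forall>i\<in>?V. A i \<in> sets P \<and> depends_on (?N i) (space P) (A i) \<and> measure P (A i) = p i"
      have "conforms H A"
        unfolding conforms_def
      proof
        fix i assume i: "i \<in> ?V"
        then obtain B where "B \<in> sets (PiM (?N i) ?U)" "A i = prod_emb ?J ?U (?N i) B"
          using cube.depends_on_imp_prod_emb[OF prob_space_unit_interval, of "A i" ?J "?N i"] A NJ[of i]
          by (auto simp: P_def)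
        then show "\<exists>B\<in>sets (cube (?N i)). A i = prod_emb ?J ?U (?N i) B"
          by (auto simp: cube_def)
      qed
      moreover have "\<forall>i\<in>?V. measure (cube ?J) (A i) = p i" unfolding cube using A by simp
      ultimately have "0 < measure (cube ?J) (space P - (\<Union>i\<in>?V. A i))"
        using p unfolding bigraph_interior_def cube space_completion none by blast
      then show "0 < measure P (space P - (\<Union>i\<in>?V. A i))"
        unfolding cube using sets_none[of A] A by simp
    qed
  }
  {
    assume R: ?R
    have "0 < measure (cube ?J) (space (cube ?J) \<inter> (\<Inter>i\<in>?V. space (cube ?J) - A i))"
      if A: "conforms H A" "\<forall>i\<in>?V. measure (cube ?J) (A i) = p i" for A
    proof -
      have "\<exists>A' Z. A' \<in> sets P \<and> depends_on (?N i) (space P) A' \<and> Z \<in> null_sets P \<and> A' \<subseteq> A i \<and> A i \<subseteq> A' \<union> Z"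
        if i: "i \<in> ?V" for i
      proof -
        from A(1) i obtain B where B: "B \<in> sets (completion (PiM (?N i) ?U))" "A i = prod_emb ?J ?U (?N i) B"
          unfolding conforms_def cube_def by blast
        then obtain S N N' where S: "B = S \<union> N" "N \<subseteq> N'" "N' \<in> null_sets (PiM (?N i) ?U)" "S \<in> sets (PiM (?N i) ?U)"
          by (elim sets_completionE)
        interpret Q: product_prob_space ?U ?J by (intro product_prob_spaceI prob_space_unit_interval)
        have fin: "finite (?N i)" using NJ finite_subset by blast
        have "emeasure P (prod_emb ?J ?U (?N i) N') = emeasure (PiM (?N i) ?U) N'"
          unfolding P_def by (rule Q.emeasure_PiM_emb'[OF NJ fin null_setsD2[OF S(3)]])
        then have "prod_emb ?J ?U (?N i) N' \<in> null_sets P"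
          using null_setsD1[OF S(3)] measurable_prod_emb[OF NJ null_setsD2[OF S(3)]] unfolding P_def
          by (intro null_setsI) simp_all
        moreover have "prod_emb ?J ?U (?N i) S \<in> sets P"
          unfolding P_def by (rule measurable_prod_emb[OF NJ S(4)])
        moreover have "depends_on (?N i) (space P) (prod_emb ?J ?U (?N i) S)"
          unfolding P_def by (rule depends_on_prod_emb[OF NJ])
        moreover have "prod_emb ?J ?U (?N i) S \<subseteq> A i" "A i \<subseteq> prod_emb ?J ?U (?N i) S \<union> prod_emb ?J ?U (?N i) N'"
          unfolding B(2) S(1) using S(2) by (auto simp: prod_emb_iff)
        ultimately show ?thesis by blast
      qed
      then obtain A' Z where A': "\<And>i. i \<in> ?V \<Longrightarrow> A' i \<in> sets P" "\<And>i. i \<in> ?V \<Longrightarrow> depends_on (?N i) (space P) (A' i)"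
        "\<And>i. i \<in> ?V \<Longrightarrow> Z i \<in> null_sets P" "\<And>i. i \<in> ?V \<Longrightarrow> A' i \<subseteq> A i" "\<And>i. i \<in> ?V \<Longrightarrow> A i \<subseteq> A' i \<union> Z i"
        by metis
      interpret CP: prob_space "completion P"
        using P.prob_space_completion .
      have Asets: "A i \<in> sets (completion P)" if "i \<in> ?V" for i
      proof -
        have "A i = A' i \<union> (A i - A' i)" "A i - A' i \<subseteq> Z i" using A'[OF that] by auto
        then show ?thesis using A'[OF that] by (intro sets_completionI[of "A i" "A' i" "A i - A' i" "Z i" P]) auto
      qed
      have mA': "measure P (A' i) = p i" if i: "i \<in> ?V" for i
      proof -
        have Zi: "Z i \<in> null_sets (completion P)" using A'(3)[OF i] by (rule null_sets_completionI)
        have "measure (completion P) (A i) = measure (completion P) (A' i)"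
        proof (rule antisym)
          have "measure (completion P) (A i) \<le> measure (completion P) (A' i \<union> Z i)"
            using A'[OF i] Zi by (intro CP.finite_measure_mono) auto
          also have "\<dots> = measure (completion P) (A' i)"
            using A'[OF i] Zi by (intro measure_Un_null_set) auto
          finally show "measure (completion P) (A i) \<le> measure (completion P) (A' i)" .
          show "measure (completion P) (A' i) \<le> measure (completion P) (A i)"
            using A'[OF i] Asets[OF i] by (intro CP.finite_measure_mono) auto
        qed
        then show ?thesis using A(2) i A'(1)[OF i] unfolding cube by simp
      qed
      have ZU: "(\<Union>i\<in>?V. Z i) \<in> null_sets (completion P)"
        using A'(3) null_sets_completionI by (intro null_sets.finite_UN) auto
      have "0 < measure P (space P - (\<Union>i\<in>?V. A' i))" using R A' mA' by blast
      also have "\<dots> = measure (completion P) (space P - (\<Union>i\<in>?V. A' i))"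
        using sets_none[of A'] A'(1) by simp
      also have "\<dots> \<le> measure (completion P) ((space P - (\<Union>i\<in>?V. A i)) \<union> (\<Union>i\<in>?V. Z i))"
      proof (rule CP.finite_measure_mono)
        show "space P - (\<Union>i\<in>?V. A' i) \<subseteq> (space P - (\<Union>i\<in>?V. A i)) \<union> (\<Union>i\<in>?V. Z i)"
          using A'(5) by blast
        have "space (completion P) - (\<Union>i\<in>?V. A i) \<in> sets (completion P)"
          using Asets by (intro sets.compl_sets sets.finite_UN) auto
        then show "(space P - (\<Union>i\<in>?V. A i)) \<union> (\<Union>i\<in>?V. Z i) \<in> sets (completion P)"
          using ZU by auto
      qed
      also have "\<dots> = measure (completion P) (space P - (\<Union>i\<in>?V. A i))"
      proof (rule measure_Un_null_set[OF _ ZU])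
        have "space (completion P) - (\<Union>i\<in>?V. A i) \<in> sets (completion P)"
          using Asets by (intro sets.compl_sets sets.finite_UN) auto
        then show "space P - (\<Union>i\<in>?V. A i) \<in> sets (completion P)" by simp
      qed
      finally show ?thesis by (simp only: cube none space_completion)
    qed
    then show "p \<in> bigraph_interior H" using R by (simp add: bigraph_interior_def)
  }
qed

section \<open>Trees are gapless\<close>

lemma sets_cube_box:
  fixes j :: "'i \<Rightarrow> nat"
  assumes "finite C" "j ` C \<subseteq> I" "\<And>c. c \<in> C \<Longrightarrow> S c \<in> sets unit_interval"
  shows "{x \<in> space (PiM I (\<lambda>_. unit_interval)). \<forall>c\<in>C. x (j c) \<in> S c} \<in> sets (PiM I (\<lambda>_. unit_interval))"
proof (rule sets.sets_Collect_finite_All[OF _ assms(1)])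
  fix c assume c: "c \<in> C"
  then have "(\<lambda>x. x (j c)) \<in> measurable (PiM I (\<lambda>_. unit_interval)) unit_interval"
    using assms(2) by (intro measurable_component_singleton) auto
  then have "(\<lambda>x. x (j c)) -` S c \<inter> space (PiM I (\<lambda>_. unit_interval)) \<in> sets (PiM I (\<lambda>_. unit_interval))"
    using assms(3)[OF c] by (rule measurable_sets)
  moreover have "(\<lambda>x. x (j c)) -` S c \<inter> space (PiM I (\<lambda>_. unit_interval)) =
      {x \<in> space (PiM I (\<lambda>_. unit_interval)). x (j c) \<in> S c}" by auto
  ultimately show "{x \<in> space (PiM I (\<lambda>_. unit_interval)). x (j c) \<in> S c} \<in> sets (PiM I (\<lambda>_. unit_interval))"
    by simp
qed

lemma depends_on_box: "j ` C \<subseteq> K \<Longrightarrow> depends_on K \<Omega> {x \<in> \<Omega>. \<forall>c\<in>C. x (j c) \<in> S c}"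
  unfolding depends_on_def by (simp add: image_subset_iff)

text \<open>A cover by events that are too small can be enlarged, each event within its own
  coordinates. Each neighbourhood must be nonempty, as an event depending on no coordinate has
  measure 0 or 1.\<close>

lemma not_in_bigraph_interior_if_cover:
  assumes H: "is_bigraph H" and V: "V = {1..nleft H}" and P: "P = PiM {1..nright H} (\<lambda>_. unit_interval)"
    and ne: "\<And>i. i \<in> V \<Longrightarrow> left_nbrs H i \<noteq> {}"
    and A: "\<And>i. i \<in> V \<Longrightarrow> A i \<in> sets P" "\<And>i. i \<in> V \<Longrightarrow> depends_on (left_nbrs H i) (space P) (A i)"
    and le: "\<And>i. i \<in> V \<Longrightarrow> measure P (A i) \<le> q i"
    and cover: "space P \<subseteq> (\<Union>i\<in>V. A i)"
  shows "q \<notin> bigraph_interior H"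
proof
  assume q: "q \<in> bigraph_interior H"
  have "\<exists>B\<in>sets P. A i \<subseteq> B \<and> depends_on (left_nbrs H i) (space P) B \<and> measure P B = q i" if i: "i \<in> V" for i
  proof -
    obtain j where j: "j \<in> left_nbrs H i" using ne[OF i] by blast
    then have "j \<in> {1..nright H}" using H by (auto simp: is_bigraph_def left_nbrs_def)
    moreover have "q i \<le> 1" using q i unfolding V bigraph_interior_def by (force simp: Pi_iff)
    ultimately show ?thesis
      using A[OF i] le[OF i] j unfolding P by (intro enlarge_to_measure) auto
  qed
  then obtain B where B: "\<And>i. i \<in> V \<Longrightarrow> B i \<in> sets P" "\<And>i. i \<in> V \<Longrightarrow> A i \<subseteq> B i"
    "\<And>i. i \<in> V \<Longrightarrow> depends_on (left_nbrs H i) (space P) (B i)" "\<And>i. i \<in> V \<Longrightarrow> measure P (B i) = q i"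
    by metis
  have "0 < measure P (space P - (\<Union>i\<in>V. B i))"
    using q B(1,3,4) unfolding bigraph_interior_borel[OF H] P[symmetric] V[symmetric] by blast
  moreover have "space P - (\<Union>i\<in>V. B i) = {}" using cover B(2) by blast
  ultimately show False by simp
qed

text \<open>The tree-exclusive family: the edge from \<open>c\<close> to its parent carries one coordinate, whose
  lower part of length \<open>t c\<close> is reserved for \<open>c\<close> and whose upper part for the parent. At a vertex
  with weight at least 1 the reserved box suffices to cover everything its descendants miss.\<close>
lemma not_in_bigraph_interior_if_weight_ge_1:
  fixes rank :: "nat \<Rightarrow> nat"
  assumes H: "is_bigraph H"
  defines "V \<equiv> {1..nleft H}" and "E \<equiv> parcs (base_graph H)"
  assumes ne: "\<And>i. i \<in> V \<Longrightarrow> left_nbrs H i \<noteq> {}"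
    and q: "\<And>i. i \<in> V \<Longrightarrow> 0 < q i"
    and rank_inj: "inj_on rank V"
    and rank_up: "\<And>v u w. v \<in> V \<Longrightarrow> u \<in> V \<Longrightarrow> (v, u) \<in> E \<Longrightarrow> w \<in> V \<Longrightarrow> (v, w) \<in> E \<Longrightarrow>
      rank v < rank u \<Longrightarrow> rank v < rank w \<Longrightarrow> u = w"
    and t: "\<And>v. t v = q v / (\<Prod>u\<in>{u \<in> V \<inter> E `` {v}. rank u < rank v}. 1 - t u)"
    and v: "v \<in> V" "1 \<le> t v" and below: "\<And>u. u \<in> V \<Longrightarrow> rank u < rank v \<Longrightarrow> t u < (1::real)"
  shows "q \<notin> bigraph_interior H"
proof -
  define P where "P = PiM {1..nright H} (\<lambda>_. unit_interval)"
  define N where "N = left_nbrs H"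
  define K where "K = (\<lambda>w. {u \<in> V \<inter> E `` {w}. rank u < rank w})"
  define D where "D = {c \<in> V. \<exists>w\<in>V. (c, w) \<in> E \<and> rank c < rank w}"
  have NI: "N i \<subseteq> {1..nright H}" for i using H by (auto simp: is_bigraph_def left_nbrs_def N_def)
  have E_iff: "(u, w) \<in> E \<longleftrightarrow> u \<in> V \<and> w \<in> V \<and> u \<noteq> w \<and> N u \<inter> N w \<noteq> {}" for u w
    by (auto simp: E_def base_graph_def V_def N_def)
  have E_sym: "(w, u) \<in> E" if "(u, w) \<in> E" for u w using that by (auto simp: E_iff)
  have "\<forall>c\<in>D. \<exists>w. w \<in> V \<and> (c, w) \<in> E \<and> rank c < rank w" by (auto simp: D_def)
  then obtain up where up: "\<And>c. c \<in> D \<Longrightarrow> up c \<in> V \<and> (c, up c) \<in> E \<and> rank c < rank (up c)" by metis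
  have "\<forall>c\<in>D. \<exists>k. k \<in> N c \<inter> N (up c)" using up by (auto simp: E_iff)
  then obtain j where j: "\<And>c. c \<in> D \<Longrightarrow> j c \<in> N c \<inter> N (up c)" by metis
  have up_eq: "up c = w" if "c \<in> D" "w \<in> V" "(c, w) \<in> E" "rank c < rank w" for c w
    using rank_up[of c "up c" w] up[OF that(1)] that by (auto simp: D_def)
  have KD: "c \<in> D" "up c = w" "rank c < rank w" "c \<in> V" if "c \<in> K w" "w \<in> V" for c w
  proof -
    show "c \<in> D" using that E_sym by (auto simp: K_def D_def)
    then show "up c = w" using that E_sym by (intro up_eq) (auto simp: K_def)
    show "rank c < rank w" "c \<in> V" using that by (auto simp: K_def)
  qed
  \<comment> \<open>If \<open>c\<close> and a higher \<open>c'\<close> used the same coordinate,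
    \<open>c\<close> would be adjacent to both \<open>c'\<close> and \<open>up c'\<close>, two
    different neighbours of higher rank.\<close>
  have j_inj: "inj_on j D"
  proof -
    have "c = c'" if c: "c \<in> D" "c' \<in> D" "j c = j c'" "rank c \<le> rank c'" for c c'
    proof (rule ccontr)
      assume "c \<noteq> c'"
      have cV: "c \<in> V" "c' \<in> V" using c by (auto simp: D_def)
      then have "rank c < rank c'" using c \<open>c \<noteq> c'\<close> rank_inj by (metis inj_onD le_neq_implies_less)
      have "j c \<in> N c \<inter> N c'" "j c \<in> N (up c')" using j[OF c(1)] j[OF c(2)] c(3) by auto
      then have "(c, c') \<in> E" using cV \<open>c \<noteq> c'\<close> by (auto simp: E_iff)
      then have 1: "up c = c'" using cV c \<open>rank c < rank c'\<close> by (intro up_eq) auto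
      have "rank c < rank (up c')" "up c' \<in> V" "up c' \<noteq> c" using up[OF c(2)] \<open>rank c < rank c'\<close> by auto
      moreover have "(c, up c') \<in> E"
        using cV j[OF c(1)] \<open>j c \<in> N (up c')\<close> calculation by (auto simp: E_iff)
      ultimately have "up c = up c'" using c by (intro up_eq) auto
      then show False using 1 up[OF c(2)] by (auto simp: E_iff)
    qed
    then show ?thesis by (intro inj_onI) (metis linear)
  qed
  have t_pos: "0 < t w" if "w \<in> V" "rank w \<le> rank v" for w
    using that below q by (subst t) (auto intro!: divide_pos_pos prod_pos)
  have finK: "finite (K w)" for w by (auto simp: K_def V_def)
  have prod_pos: "0 < (\<Prod>c\<in>K w. 1 - t c)" if "w \<in> V" "rank w \<le> rank v" for w
    using that below KD(3,4) by (intro prod_pos) fastforce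
  have t_mult: "t w * (\<Prod>c\<in>K w. 1 - t c) = q w" if "w \<in> V" "rank w \<le> rank v" for w
    using prod_pos[OF that] by (subst t) (auto simp: K_def)
  have m_hi: "measure unit_interval {t c..1} = 1 - t c" and s_hi: "{t c..1} \<in> sets unit_interval"
    if "c \<in> V" "rank c < rank v" for c
    using t_pos[of c] below[of c] that by (auto simp: measure_restrict_space sets_unit_interval_iff)
  have m_lo: "measure unit_interval {0..<t c} = t c" and s_lo: "{0..<t c} \<in> sets unit_interval"
    if "c \<in> V" "rank c < rank v" for c
  proof -
    have tc: "0 < t c" "t c < 1" using t_pos[of c] below[of c] that by auto
    show "measure unit_interval {0..<t c} = t c"
      using measure_unit_interval_atLeastLessThan[of 0 "t c"] tc by simp
    have "{0..<t c} \<subseteq> {0..1}" using tc by auto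
    then show "{0..<t c} \<in> sets unit_interval" unfolding sets_unit_interval_iff by simp
  qed
  \<comment> \<open>An event takes the lower part of its own parent edge and the upper parts of the
    edges to its children. Below \<open>v\<close> this box has measure \<open>t w\<close> times the
    product of \<open>1 - t c\<close>, which is \<open>q w\<close>: the recursion for
    \<open>t\<close> is made for this.\<close>
  define S where "S = (\<lambda>w c. if c = w then {0..<t w} else {t c..1})"
  define box where "box = (\<lambda>C w. {x \<in> space P. \<forall>c\<in>C. x (j c) \<in> S w c})"
  \<comment> \<open>At \<open>v\<close> the condition on a parent edge is dropped: as
    \<open>t v\<close> is at least 1, the box given by the children alone already has measure at
    most \<open>q v\<close>.\<close>
  define C where "C = (\<lambda>w. if w = v then K w else insert w (K w))"
  define A where "A = (\<lambda>w. if w = v \<or> w \<in> D \<and> rank w < rank v then box (C w) w else {})"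
  have wK: "w \<notin> K w" for w by (auto simp: K_def)
  have jK: "j ` K w \<subseteq> N w" if "w \<in> V" for w using j KD that by fastforce
  have C: "finite (C w)" "inj_on j (C w)" "j ` C w \<subseteq> N w" "\<And>c. c \<in> C w \<Longrightarrow> S w c \<in> sets unit_interval"
    "measure P (box (C w) w) \<le> q w"
    if w: "w \<in> V" "w = v \<or> w \<in> D \<and> rank w < rank v" for w
  proof -
    show fin: "finite (C w)" using finK by (simp add: C_def)
    have CD: "C w \<subseteq> D" using KD(1) w by (auto simp: C_def)
    then show inj: "inj_on j (C w)" by (rule inj_on_subset[OF j_inj])
    have "j w \<in> N w" if "w \<noteq> v" using j[of w] w(2) that by blast
    then show jN: "j ` C w \<subseteq> N w" using jK[OF w(1)] by (cases "w = v") (simp_all add: C_def)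
    have KS: "S w c = {t c..1}" "c \<in> V" "rank c < rank v" if "c \<in> K w" for c
      using that wK[of w] KD(3,4)[OF that w(1)] w by (auto simp: S_def)
    have S_sets: "S w c \<in> sets unit_interval" if "c \<in> C w" for c
    proof (cases "c \<in> K w")
      case True
      then show ?thesis using KS s_hi by auto
    next
      case False
      then have "c = w" "w \<noteq> v" using that by (auto simp: C_def split: if_splits)
      then show ?thesis using w s_lo by (auto simp: S_def)
    qed
    then show "\<And>c. c \<in> C w \<Longrightarrow> S w c \<in> sets unit_interval" .
    have box_prod: "measure P (box (C w) w) = (\<Prod>c\<in>C w. measure unit_interval (S w c))"
      unfolding box_def P_def using fin inj jN NI[of w] S_sets by (intro measure_cube_box) auto
    have K_prod: "(\<Prod>c\<in>K w. measure unit_interval (S w c)) = (\<Prod>c\<in>K w. 1 - t c)"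
      using KS m_hi by (intro prod.cong) auto
    show "measure P (box (C w) w) \<le> q w"
    proof (cases "w = v")
      case True
      have "1 * (\<Prod>c\<in>K v. 1 - t c) \<le> t v * (\<Prod>c\<in>K v. 1 - t c)"
        using v prod_pos[OF v(1)] by (intro mult_right_mono) auto
      then show ?thesis using True box_prod K_prod t_mult[OF v(1)] by (simp add: C_def)
    next
      case False
      then have "measure unit_interval (S w w) = t w" using w m_lo[of w] by (simp add: S_def)
      then show ?thesis
        using False box_prod K_prod t_mult[OF w(1)] w(2) finK[of w] wK[of w] by (simp add: C_def)
    qed
  qed
  have "space P \<subseteq> (\<Union>i\<in>V. A i)"
  proof
    fix x assume x: "x \<in> space P"
    have x01: "x (j c) \<in> {0..1}" if "c \<in> D" for c
      using x j[OF that] NI[of c] by (auto simp: P_def space_PiM PiE_iff space_unit_interval)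
    show "x \<in> (\<Union>i\<in>V. A i)"
    proof (rule ccontr)
      assume no: "x \<notin> (\<Union>i\<in>V. A i)"
      \<comment> \<open>A point missed by all events meets the conditions of \<open>w\<close> on the
        edges to its children, by induction, so it must violate the one on its parent edge. At
        \<open>v\<close> there is no such condition left to violate.\<close>
      have hi: "t w \<le> x (j w)" if "w \<in> D" "rank w < rank v" for w
        using that
      proof (induction "rank w" arbitrary: w rule: less_induct)
        case less
        have wV: "w \<in> V" using less.prems by (simp add: D_def)
        have kids: "x (j c) \<in> S w c" if "c \<in> K w" for c
          using less.hyps[of c] KD[OF that wV] less.prems x01[of c] wK[of w] that by (auto simp: S_def)
        have "x \<notin> box (C w) w" using no less.prems wV by (auto simp: A_def)
        moreover have "w \<noteq> v" using less.prems by auto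
        ultimately have "x (j w) \<notin> S w w" using kids x by (auto simp: box_def C_def)
        then show ?case using x01[OF less.prems(1)] by (auto simp: S_def)
      qed
      have "x (j c) \<in> S v c" if c: "c \<in> K v" for c
        using hi[of c] KD[OF c v(1)] x01[of c] by (auto simp: S_def)
      then have "x \<in> A v" using x by (simp add: A_def box_def C_def)
      then show False using no v by blast
    qed
  qed
  moreover have "A i \<in> sets P" "depends_on (left_nbrs H i) (space P) (A i)" "measure P (A i) \<le> q i" if i: "i \<in> V" for i
  proof -
    have "A i \<in> sets P \<and> depends_on (N i) (space P) (A i) \<and> measure P (A i) \<le> q i"
    proof (cases "i = v \<or> i \<in> D \<and> rank i < rank v")
      case True
      then have "A i = box (C i) i" by (auto simp: A_def)
      moreover have "box (C i) i \<in> sets P"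
        unfolding box_def P_def using C[OF i True] NI[of i] by (intro sets_cube_box) auto
      moreover have "depends_on (N i) (space P) (box (C i) i)"
        unfolding box_def using C[OF i True] by (intro depends_on_box)
      ultimately show ?thesis using C[OF i True] by simp
    next
      case False
      then have "A i = {}" by (auto simp: A_def)
      then show ?thesis using q[OF i] by (simp add: depends_on_def)
    qed
    then show "A i \<in> sets P" "depends_on (left_nbrs H i) (space P) (A i)" "measure P (A i) \<le> q i"
      by (simp_all add: N_def)
  qed
  ultimately show ?thesis
    by (intro not_in_bigraph_interior_if_cover[OF H, of V P A q] ne) (simp_all add: V_def P_def)
qed

lemma dependency_graph_avoidance:
  assumes M: "prob_space M" and G: "pair_graph G" and A: "A \<in> pverts G \<rightarrow> sets M"
    and pos: "\<And>v. v \<in> pverts G \<Longrightarrow> 0 < measure M (A v)" and dep: "dependency_graph G M A"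
  shows "avoidance (pverts G) (parcs G) (\<lambda>v. measure M (A v)) (\<lambda>S. measure M (space M - (\<Union>u\<in>S. A u)))"
proof -
  interpret prob_space M by (rule M)
  interpret G: pair_graph G by (rule G)
  show ?thesis
  proof (rule avoidance_of_independence[OF M])
    show "(v, u) \<in> parcs G" if "(u, v) \<in> parcs G" for u v
      using that G.pair_sym_arcs by (auto simp: symmetric_def elim: symE)
    show "(v, v) \<notin> parcs G" for v using G.pair_no_loops by fastforce
    fix v S assume v: "v \<in> pverts G" and S: "S \<subseteq> pverts G - {v} - parcs G `` {v}"
    define J where "J = {j \<in> pverts G. j \<noteq> v \<and> (v, j) \<notin> parcs G}"
    have "finite S" using S G.pair_finite_verts by (meson Diff_subset finite_subset)
    then have "(\<Union>u\<in>S. A u) \<in> sigma_sets (space M) (A ` J)"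
      using S by (intro sigma_sets_UNION) (auto simp: J_def countable_finite)
    then have "space M - (\<Union>u\<in>S. A u) \<in> sigma_sets (space M) (A ` J)" by (rule sigma_sets.Compl)
    moreover have "indep_set {A v} (sigma_sets (space M) (A ` J))"
      using dep v unfolding dependency_graph_def J_def by blast
    ultimately show "prob (A v \<inter> (space M - (\<Union>u\<in>S. A u))) = prob (A v) * prob (space M - (\<Union>u\<in>S. A u))"
      unfolding indep_sets2_eq by blast
  qed (use A pos G.pair_finite_verts in auto)
qed

lemma tree_a_gapless:
  fixes G :: "nat pair_pre_digraph"
  assumes G: "pair_graph G" and conn: "Digraph_Component.connected G"
    and acyclic: "\<not> (\<exists>c. pre_digraph.cycle G c \<and> 3 \<le> length c)"
  shows "a_gapless G"
proof
  assume "a_gapful G"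
  then obtain H q where H: "is_bigraph H" "base_graph H = G"
    and q: "q \<in> bigraph_interior H" "q \<notin> abstract_interior G"
    unfolding a_gapful_def gapful_def by blast
  interpret G: pair_graph G by (rule G)
  define V where "V = pverts G"
  define E where "E = parcs G"
  have V: "V = {1..nleft H}" using H(2) by (auto simp: V_def base_graph_def)
  have q01: "0 < q i" "q i < 1" if "i \<in> V" for i
    using q(1) that unfolding bigraph_interior_def V by (auto simp: Pi_iff)
  have low_degree: "\<exists>v\<in>S. \<forall>u\<in>S \<inter> E `` {v}. \<forall>w\<in>S \<inter> E `` {v}. u = w" if "S \<subseteq> V" "S \<noteq> {}" for S
    using min_degree_two_cycle[OF G, of S] that acyclic unfolding V_def E_def by blast
  have finV: "finite V" using V by simp
  have "\<exists>rank :: nat \<Rightarrow> nat. inj_on rank V \<and>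
    (\<forall>v\<in>V. \<forall>u\<in>V \<inter> E `` {v}. \<forall>w\<in>V \<inter> E `` {v}. rank v < rank u \<longrightarrow> rank v < rank w \<longrightarrow> u = w)"
    by (rule elimination_rank[OF finV]) (rule low_degree)
  then obtain rank :: "nat \<Rightarrow> nat" where rank: "inj_on rank V"
    "\<forall>v\<in>V. \<forall>u\<in>V \<inter> E `` {v}. \<forall>w\<in>V \<inter> E `` {v}. rank v < rank u \<longrightarrow> rank v < rank w \<longrightarrow> u = w"
    by (elim exE conjE)
  from ex_tree_weights[of q V E rank]
  obtain t where t_eq: "\<forall>v. t v = q v / (\<Prod>u\<in>{u \<in> V \<inter> E `` {v}. rank u < rank v}. 1 - t u)" ..
  note t = t_eq[rule_format]
  show False
  proof (cases "\<forall>v\<in>V. t v < 1")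
    case True
    have "q \<in> abstract_interior G"
      unfolding abstract_interior_def
    proof (intro CollectI conjI allI impI)
      show "q \<in> pverts G \<rightarrow> {0<..<1}" using q01 by (auto simp: V_def)
      fix M :: "nat set measure" and A
      assume A: "prob_space M \<and> A \<in> pverts G \<rightarrow> sets M \<and> (\<forall>i\<in>pverts G. measure M (A i) = q i) \<and> dependency_graph G M A"
      then have M: "prob_space M" and AM: "A \<in> pverts G \<rightarrow> sets M" and dep: "dependency_graph G M A"
        and mA: "\<And>v. v \<in> V \<Longrightarrow> measure M (A v) = q v"
        by (simp_all add: V_def)
      define f where "f = (\<lambda>S. measure M (space M - (\<Union>u\<in>S. A u)))"
      interpret avoidance V E "\<lambda>v. measure M (A v)" f
        unfolding V_def E_def f_def
        by (rule dependency_graph_avoidance[OF M G AM _ dep]) (simp add: mA q01 flip: V_def)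
      have "0 < f V"
      proof (rule tree_avoidance_pos[OF rank(1)])
        show "u = w" if "v \<in> V" "u \<in> V" "(v, u) \<in> E" "w \<in> V" "(v, w) \<in> E" "rank v < rank u" "rank v < rank w" for v u w
          using rank(2) that by blast
        show "t v = measure M (A v) / (\<Prod>u\<in>{u \<in> V \<inter> E `` {v}. rank u < rank v}. 1 - t u)" if "v \<in> V" for v
          unfolding mA[OF that] by (rule t)
        show "t v < 1" if "v \<in> V" for v using True that by blast
      qed
      moreover have "space M \<inter> (\<Inter>i\<in>pverts G. space M - A i) = space M - (\<Union>u\<in>V. A u)"
        by (auto simp: V_def)
      ultimately show "0 < measure M (space M \<inter> (\<Inter>i\<in>pverts G. space M - A i))" by (simp add: f_def)
    qed
    then show False using q by simp
  next
    case False
    then have "\<exists>v. v \<in> V \<and> 1 \<le> t v" by (auto simp: not_less)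
    \<comment> \<open>Least rank is essential: beyond a weight that reaches 1, denominators may be
      zero or negative.\<close>
    then obtain v where v: "v \<in> V" "1 \<le> t v" and least: "\<And>u. u \<in> V \<Longrightarrow> 1 \<le> t u \<Longrightarrow> rank v \<le> rank u"
      using ex_has_least_nat[of "\<lambda>v. v \<in> V \<and> 1 \<le> t v" _ rank] by blast
    \<comment> \<open>A vertex without children has weight \<open>q v < 1\<close>. So
      \<open>v\<close> has a neighbour, \<open>G\<close> has at least two vertices, and
      connectedness gives every vertex a coordinate.\<close>
    have "{u \<in> V \<inter> E `` {v}. rank u < rank v} \<noteq> {}"
    proof
      assume "{u \<in> V \<inter> E `` {v}. rank u < rank v} = {}"
      then have "t v = q v" using t[of v] by (simp only: prod.empty div_by_1)
      then show False using v q01(2)[OF v(1)] by simp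
    qed
    then obtain u where u: "u \<in> V" "(v, u) \<in> E" "rank u < rank v" by auto
    have ne: "left_nbrs H i \<noteq> {}" if i: "i \<in> V" for i
    proof -
      have "{i} \<noteq> V" using u v by auto
      then obtain w where "(w, i) \<in> parcs G" using connected_cut[OF G conn, of "{i}"] i by (auto simp: V_def)
      then show ?thesis using H(2) by (auto simp: base_graph_def)
    qed
    have "q \<notin> bigraph_interior H"
    proof (rule not_in_bigraph_interior_if_weight_ge_1[OF H(1), of q rank t v])
      show "u = w" if "v \<in> {1..nleft H}" "u \<in> {1..nleft H}" "(v, u) \<in> parcs (base_graph H)"
          "w \<in> {1..nleft H}" "(v, w) \<in> parcs (base_graph H)" "rank v < rank u" "rank v < rank w" for v u w
        using rank(2) that H(2) unfolding V E_def by blast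
      show "t v = q v / (\<Prod>u\<in>{u \<in> {1..nleft H} \<inter> parcs (base_graph H) `` {v}. rank u < rank v}. 1 - t u)" for v
        using t[of v] H(2) unfolding V E_def by simp
      show "t u < 1" if "u \<in> {1..nleft H}" "rank u < rank v" for u
        using least[of u] that unfolding V by fastforce
    qed (use ne q01 rank(1) v in \<open>simp_all add: V\<close>)
    then show False using q by simp
  qed
qed

section \<open>Graphs with a cycle are gapful\<close>

text \<open>The intended \<open>h\<close> enumerates the undirected edges as two-element vertex
  sets, so that opposite arcs share one coordinate.\<close>

definition edge_bigraph :: "nat \<Rightarrow> nat \<Rightarrow> (nat \<Rightarrow> nat set) \<Rightarrow> bigraph" where
  "edge_bigraph n m h =
     \<lparr>nleft = n, nright = m, bedges = {(i, j). i \<in> {1..n} \<and> j \<in> {1..m} \<and> i \<in> h j}\<rparr>"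

lemma left_nbrs_edge_bigraph:
  "i \<in> {1..n} \<Longrightarrow> left_nbrs (edge_bigraph n m h) i = {j \<in> {1..m}. i \<in> h j}"
  by (auto simp: left_nbrs_def edge_bigraph_def)

lemma base_graph_edge_bigraph:
  assumes G: "pair_graph G" "pverts G = {1..n}"
    and h: "h ` {1..m} = (\<lambda>(u, w). {u, w}) ` parcs G"
  shows "base_graph (edge_bigraph n m h) = G"
proof -
  interpret pair_graph G by (rule G)
  have shared: "(u, w) \<in> parcs G" if uw: "u \<in> {1..n}" "w \<in> {1..n}" "u \<noteq> w"
    and k: "k \<in> left_nbrs (edge_bigraph n m h) u" "k \<in> left_nbrs (edge_bigraph n m h) w" for u w k
  proof -
    have "k \<in> {1..m}" "u \<in> h k" "w \<in> h k" using k uw by (simp_all add: left_nbrs_edge_bigraph)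
    moreover have "h k \<in> (\<lambda>(u, w). {u, w}) ` parcs G" using h \<open>k \<in> {1..m}\<close> by blast
    ultimately obtain a b where ab: "(a, b) \<in> parcs G" "u \<in> {a, b}" "w \<in> {a, b}" by auto
    then have "(b, a) \<in> parcs G" using pair_sym_arcs by (auto simp: symmetric_def elim: symE)
    then show ?thesis using ab uw(3) by auto
  qed
  have edge: "u \<in> {1..n} \<and> w \<in> {1..n} \<and> u \<noteq> w \<and>
      left_nbrs (edge_bigraph n m h) u \<inter> left_nbrs (edge_bigraph n m h) w \<noteq> {}"
    if e: "(u, w) \<in> parcs G" for u w
  proof -
    have uw: "u \<in> {1..n}" "w \<in> {1..n}" "u \<noteq> w"
      using in_arcsD1[OF e] in_arcsD2[OF e] pair_no_loops[OF e] G(2) by auto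
    have "{u, w} \<in> h ` {1..m}" unfolding h using e by force
    then obtain k where "k \<in> {1..m}" "h k = {u, w}" by auto
    then have "k \<in> left_nbrs (edge_bigraph n m h) u" "k \<in> left_nbrs (edge_bigraph n m h) w"
      using uw by (simp_all add: left_nbrs_edge_bigraph)
    then show ?thesis using uw by blast
  qed
  have "nleft (edge_bigraph n m h) = n" by (simp add: edge_bigraph_def)
  then have "(u, w) \<in> parcs (base_graph (edge_bigraph n m h)) \<longleftrightarrow> u \<in> {1..n} \<and> w \<in> {1..n} \<and> u \<noteq> w \<and>
      left_nbrs (edge_bigraph n m h) u \<inter> left_nbrs (edge_bigraph n m h) w \<noteq> {}" for u w
    by (simp only: base_graph_def pair_pre_digraph.simps mem_Collect_eq case_prod_conv)
  then have "(u, w) \<in> parcs (base_graph (edge_bigraph n m h)) \<longleftrightarrow> (u, w) \<in> parcs G" for u w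
    using shared[of u w] edge[of u w] by blast
  then have "parcs (base_graph (edge_bigraph n m h)) = parcs G" by (intro set_eqI) (metis prod.collapse)
  moreover have "pverts (base_graph (edge_bigraph n m h)) = pverts G"
    using G(2) by (simp add: base_graph_def edge_bigraph_def)
  ultimately show ?thesis by simp
qed

text \<open>If the family covered the cube, adjacent events would be disjoint up to null sets, so each
  edge coordinate would be split into a part forbidden to one endpoint and a part forbidden to the
  other. Letting each \<open>v\<close> lose on its own edge \<open>{v, \<sigma> v}\<close> leaves a box of positive measure.\<close>
lemma critical_in_bigraph_interior:
  fixes p :: real
  assumes G: "pair_graph G" "pverts G = {1..n}" and conn: "Digraph_Component.connected G"
    and h: "bij_betw h {1..m} ((\<lambda>(u, w). {u, w}) ` parcs G)"
    and \<sigma>: "\<And>v. v \<in> {1..n} \<Longrightarrow> (v, \<sigma> v) \<in> parcs G \<and> \<sigma> (\<sigma> v) \<noteq> v"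
    and p: "0 < p" "p < 1" and zero: "indep_poly (parcs G) (\<lambda>_. p) {1..n} = 0"
    and pos: "\<And>S. S \<subset> {1..n} \<Longrightarrow> 0 < indep_poly (parcs G) (\<lambda>_. p) S"
  shows "(\<lambda>_. p) \<in> bigraph_interior (edge_bigraph n m h)"
proof -
  interpret G: pair_graph G by (rule G)
  define H where "H = edge_bigraph n m h"
  define V where "V = {1..n}"
  define E where "E = parcs G"
  define N where "N = left_nbrs H"
  define P where "P = PiM {1..m} (\<lambda>_ :: nat. unit_interval)"
  interpret P: prob_space P unfolding P_def by (rule prob_space_cube)
  have fin: "finite V" by (simp add: V_def)
  have E_sym: "(w, u) \<in> E" if "(u, w) \<in> E" for u w
    using that G.pair_sym_arcs by (auto simp: E_def symmetric_def elim: symE)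
  have E_irrefl: "(u, u) \<notin> E" for u using G.pair_no_loops by (fastforce simp: E_def)
  have EV: "u \<in> V" "w \<in> V" if "(u, w) \<in> E" for u w
    using G.in_arcsD1 G.in_arcsD2 that G(2) by (auto simp: E_def V_def)
  have H: "is_bigraph H" "nleft H = n" "nright H = m" by (auto simp: H_def is_bigraph_def edge_bigraph_def)
  have N: "N i = {k \<in> {1..m}. i \<in> h k}" if "i \<in> V" for i
    using that by (simp add: N_def H_def V_def left_nbrs_edge_bigraph)
  have hE: "\<exists>a b. (a, b) \<in> E \<and> h k = {a, b}" if "k \<in> {1..m}" for k
  proof -
    have "h k \<in> (\<lambda>(u, w). {u, w}) ` parcs G" using bij_betwE[OF h] that by blast
    then show ?thesis by (auto simp: E_def)
  qed
  have N_disj: "N u \<inter> N w = {}" if uw: "u \<in> V" "w \<in> V" "u \<noteq> w" "(u, w) \<notin> E" for u w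
  proof (rule ccontr)
    assume "N u \<inter> N w \<noteq> {}"
    then obtain k where k: "k \<in> {1..m}" "u \<in> h k" "w \<in> h k" using N[OF uw(1)] N[OF uw(2)] by auto
    then obtain a b where "(a, b) \<in> E" "h k = {a, b}" using hE by blast
    then show False using k uw E_sym[of a b] by auto
  qed
  define je where "je = (\<lambda>v. the_inv_into {1..m} h {v, \<sigma> v})"
  have je: "je v \<in> {1..m}" "h (je v) = {v, \<sigma> v}" if "v \<in> V" for v
  proof -
    have "{v, \<sigma> v} \<in> (\<lambda>(u, w). {u, w}) ` parcs G"
      using \<sigma>[of v] that by (intro image_eqI[of _ _ "(v, \<sigma> v)"]) (simp_all add: V_def)
    then have "{v, \<sigma> v} \<in> h ` {1..m}" using h by (simp add: bij_betw_def)
    then obtain k where k: "k \<in> {1..m}" "h k = {v, \<sigma> v}" by (metis imageE)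
    then have "je v = k" using the_inv_into_f_f[OF bij_betw_imp_inj_on[OF h], of k] by (simp add: je_def)
    then show "je v \<in> {1..m}" "h (je v) = {v, \<sigma> v}" using k by simp_all
  qed
  have \<sigma>V: "\<sigma> v \<in> V" "(v, \<sigma> v) \<in> E" "\<sigma> v \<noteq> v" if "v \<in> V" for v
  proof -
    show e: "(v, \<sigma> v) \<in> E" using \<sigma>[of v] that by (simp add: V_def E_def)
    show "\<sigma> v \<in> V" by (rule EV(2)[OF e])
    show "\<sigma> v \<noteq> v" using e E_irrefl[of v] by auto
  qed
  \<comment> \<open>Two different vertices could be matched to the same edge only if
    \<open>\<sigma>\<close> swapped them.\<close>
  have je_inj: "inj_on je V"
  proof (rule inj_onI)
    fix v w assume vw: "v \<in> V" "w \<in> V" "je v = je w"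
    then have "{v, \<sigma> v} = {w, \<sigma> w}" using je(2) by metis
    moreover have "\<sigma> (\<sigma> v) \<noteq> v" using \<sigma>[of v] vw by (simp add: V_def)
    ultimately show "v = w" by (auto simp: doubleton_eq_iff)
  qed
  have N_edge: "N v \<inter> N (\<sigma> v) \<subseteq> {je v}" if v: "v \<in> V" for v
  proof
    fix k assume "k \<in> N v \<inter> N (\<sigma> v)"
    then have k: "k \<in> {1..m}" "v \<in> h k" "\<sigma> v \<in> h k" using N[OF v] N[OF \<sigma>V(1)[OF v]] by auto
    then obtain a b where "h k = {a, b}" using hE[OF k(1)] by metis
    then have "h k = h (je v)" using k(2,3) je(2)[OF v] \<sigma>V(3)[OF v] by auto
    then have "k = je v" using bij_betw_imp_inj_on[OF h] k(1) je(1)[OF v] by (auto dest: inj_onD)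
    then show "k \<in> {je v}" by simp
  qed
  have "0 < measure P (space P - (\<Union>i\<in>V. A i))"
    if A: "\<And>i. i \<in> V \<Longrightarrow> A i \<in> sets P" "\<And>i. i \<in> V \<Longrightarrow> depends_on (N i) (space P) (A i)"
      "\<And>i. i \<in> V \<Longrightarrow> measure P (A i) = p" for A
  proof (rule ccontr)
    assume "\<not> ?thesis"
    then have cover: "measure P (space P - (\<Union>i\<in>V. A i)) = 0"
      by (simp add: not_less measure_le_0_iff)
    define f where "f = (\<lambda>S. measure P (space P - (\<Union>i\<in>S. A i)))"
    have none: "space P - (\<Union>i\<in>S. A i) \<in> sets P" if "S \<subseteq> V" for S
      using that A(1) finite_subset[OF that fin] by (intro sets.compl_sets sets.finite_UN) auto
    interpret avoidance V E "\<lambda>v. measure P (A v)" f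
      unfolding f_def
    proof (rule avoidance_of_independence[OF P.prob_space_axioms fin])
      fix v S assume v: "v \<in> V" and S: "S \<subseteq> V - {v} - E `` {v}"
      then have SV: "S \<subseteq> V" by blast
      have "depends_on (\<Union>u\<in>S. N u) (space P) (space P - (\<Union>u\<in>S. A u))"
        using SV A(2) by (intro depends_on_Diff_UN) blast
      moreover have "N v \<inter> (\<Union>u\<in>S. N u) = {}" using S v N_disj[of v] by blast
      ultimately have "emeasure P (A v \<inter> (space P - (\<Union>u\<in>S. A u))) =
          emeasure P (A v) * emeasure P (space P - (\<Union>u\<in>S. A u))"
        using A(1)[OF v] A(2)[OF v] none[OF SV] unfolding P_def
        by (intro cube.emeasure_Int_depends_on[OF prob_space_unit_interval]) simp_all
      then show "measure P (A v \<inter> (space P - (\<Union>u\<in>S. A u))) =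
          measure P (A v) * measure P (space P - (\<Union>u\<in>S. A u))"
        by (simp add: measure_def enn2real_mult)
    qed (use A p E_sym E_irrefl in simp_all)
    have poly: "indep_poly E (\<lambda>v. measure P (A v)) S = indep_poly E (\<lambda>_. p) S" if "S \<subseteq> V" for S
      unfolding indep_poly_def using that A(3) by (intro sum.cong refl prod.cong) auto
    have fS: "f S = indep_poly E (\<lambda>_. p) S" if S: "S \<subset> V" for S
    proof -
      have "f S = indep_poly E (\<lambda>v. measure P (A v)) S"
      proof (rule avoidance_eq_indep_poly)
        show "f V = 0" using cover by (simp add: f_def)
        show "indep_poly E (\<lambda>v. measure P (A v)) V = 0" using zero poly[of V] by (simp add: V_def E_def)
        show "0 < indep_poly E (\<lambda>v. measure P (A v)) S" if "S \<subset> V" for S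
          using pos[of S] poly[of S] that by (simp add: V_def E_def psubset_imp_subset)
        show "\<exists>v\<in>V - W. \<exists>w\<in>W. (v, w) \<in> E" if "W \<subseteq> V" "W \<noteq> {}" "W \<noteq> V" for W
          using connected_cut[OF G(1) conn, of W] that G(2) by (simp add: V_def E_def)
      qed (rule S)
      then show ?thesis using poly[of S] S by simp
    qed
    have disj: "emeasure P (A v \<inter> A (\<sigma> v)) = 0" if v: "v \<in> V" for v
    proof -
      define w where "w = \<sigma> v"
      have w: "w \<in> V" "(v, w) \<in> E" "w \<noteq> v" using \<sigma>V[OF v] by (simp_all add: w_def)
      \<comment> \<open>\<open>\<sigma> w\<close> is a third vertex, so the pair is a proper subset
        of \<open>V\<close> and \<open>fS\<close> applies. Its avoidance probability
        \<open>1 - 2 * p\<close> leaves no room for an overlap of two events of probability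
        \<open>p\<close>.\<close>
      have "\<sigma> w \<in> V" "\<sigma> w \<noteq> w" "\<sigma> w \<noteq> v" using \<sigma>V[OF w(1)] \<sigma>[of v] v by (simp_all add: w_def V_def)
      then have vw: "insert w {v} \<subset> V" using v w by auto
      have "indep_poly E (\<lambda>_. p) (insert w {v}) = indep_poly E (\<lambda>_. p) {v} - p * indep_poly E (\<lambda>_. p) ({v} - E `` {w})"
        using w E_sym E_irrefl by (intro indep_poly_insert) auto
      moreover have "{v} - E `` {w} = {}" using w E_sym by auto
      moreover have "indep_poly E (\<lambda>_. p) {v} = 1 - p"
        using indep_poly_insert[of "{}" v E "\<lambda>_. p"] E_sym E_irrefl by simp
      ultimately have "f {w, v} = 1 - p - p" using fS[OF vw] by simp
      moreover have "f {w, v} = 1 - measure P (A w \<union> A v)"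
        unfolding f_def using A(1)[OF v] A(1)[OF w(1)] by (subst P.prob_compl) auto
      moreover have "measure P (A w \<union> A v) = measure P (A w) + measure P (A v) - measure P (A w \<inter> A v)"
        using A(1)[OF v] A(1)[OF w(1)] P.fmeasurable_eq_sets by (intro measure_Un3) auto
      ultimately have "measure P (A v \<inter> A w) = 0" using A(3)[OF v] A(3)[OF w(1)] by (simp add: Int_commute)
      then show ?thesis by (simp add: P.emeasure_eq_measure w_def)
    qed
    have forbidden: "\<exists>Y\<in>sets unit_interval. 0 < measure unit_interval Y \<and> {x \<in> A v. x (je v) \<in> Y} \<in> null_sets P" if v: "v \<in> V" for v
    proof -
      have "\<exists>X\<in>sets unit_interval. emeasure P {x \<in> A v. x (je v) \<notin> X} = 0 \<and>
          emeasure P {x \<in> A (\<sigma> v). x (je v) \<in> X} = 0"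
        using A(1,2)[OF v] A(1,2)[OF \<sigma>V(1)[OF v]] N_edge[OF v] disj[OF v] je(1)[OF v] unfolding P_def
        by (intro cube.null_Int_separated[OF prob_space_unit_interval, where K = "N v" and L = "N (\<sigma> v)"]) simp_all
      then obtain X where X: "X \<in> sets unit_interval" "emeasure P {x \<in> A v. x (je v) \<notin> X} = 0"
        "emeasure P {x \<in> A (\<sigma> v). x (je v) \<in> X} = 0" by blast
      \<comment> \<open>Outside \<open>X\<close> the event at \<open>v\<close> almost never occurs.
        \<open>Y\<close> is not null: otherwise \<open>A (\<sigma> v)\<close> would lie in
        \<open>X\<close> up to a null set, where it has measure 0, contradicting
        \<open>p > 0\<close>.\<close>
      define Y where "Y = space unit_interval - X"
      have Y: "Y \<in> sets unit_interval" using X(1) unfolding Y_def by (rule sets.compl_sets)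
      have slab: "{x \<in> space P. x (je v) \<in> Z} \<in> sets P" if "Z \<in> sets unit_interval" for Z
        using sets_cube_box[of "{v}" je "{1..m}" "\<lambda>_. Z"] je(1)[OF v] that by (simp add: P_def)
      have slab_A: "{x \<in> A u. x (je v) \<in> Z} \<in> sets P" if "Z \<in> sets unit_interval" "u \<in> V" for Z u
      proof -
        have "{x \<in> A u. x (je v) \<in> Z} = A u \<inter> {x \<in> space P. x (je v) \<in> Z}"
          using sets.sets_into_space[OF A(1)[OF that(2)]] by auto
        then show ?thesis using slab[OF that(1)] A(1)[OF that(2)] by simp
      qed
      have coord: "x (je v) \<in> space unit_interval" if "x \<in> A u" "u \<in> V" for x u
        using sets.sets_into_space[OF A(1)[OF that(2)]] that(1) je(1)[OF v]
        by (auto simp: P_def space_PiM PiE_iff)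
      have "{x \<in> A v. x (je v) \<in> Y} = {x \<in> A v. x (je v) \<notin> X}"
        using coord v by (auto simp: Y_def)
      then have "{x \<in> A v. x (je v) \<in> Y} \<in> null_sets P"
        using X(2) slab_A[OF Y v] by (intro null_setsI) simp_all
      moreover have "measure unit_interval Y \<noteq> 0"
      proof
        assume Y0: "measure unit_interval Y = 0"
        have "measure P {x \<in> space P. x (je v) \<in> Y} = 0"
          using measure_cube_box[of "{v}" je "{1..m}" "\<lambda>_. Y"] je(1)[OF v] Y Y0 by (simp add: P_def)
        then have "{x \<in> space P. x (je v) \<in> Y} \<in> null_sets P"
          using slab[OF Y] by (intro null_setsI) (simp_all add: P.emeasure_eq_measure)
        moreover have "{x \<in> A (\<sigma> v). x (je v) \<in> X} \<in> null_sets P"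
          using X(3) slab_A[OF X(1) \<sigma>V(1)[OF v]] by (intro null_setsI)
        ultimately have "{x \<in> A (\<sigma> v). x (je v) \<in> X} \<union> {x \<in> space P. x (je v) \<in> Y} \<in> null_sets P" by blast
        moreover have "A (\<sigma> v) \<subseteq> {x \<in> A (\<sigma> v). x (je v) \<in> X} \<union> {x \<in> space P. x (je v) \<in> Y}"
          using coord[OF _ \<sigma>V(1)[OF v]] sets.sets_into_space[OF A(1)[OF \<sigma>V(1)[OF v]]] by (auto simp: Y_def)
        ultimately have "A (\<sigma> v) \<in> null_sets P" using null_sets_subset A(1)[OF \<sigma>V(1)[OF v]] by blast
        then have "measure P (A (\<sigma> v)) = 0" by (simp add: measure_def null_setsD1)
        then show False using A(3)[OF \<sigma>V(1)[OF v]] p by simp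
      qed
      ultimately show ?thesis using Y by (intro bexI[of _ Y] conjI) (simp_all add: zero_less_measure_iff)
    qed
    have "\<forall>v\<in>V. \<exists>Y. Y \<in> sets unit_interval \<and> 0 < measure unit_interval Y \<and>
        {x \<in> A v. x (je v) \<in> Y} \<in> null_sets P"
      using forbidden by blast
    then obtain Y where "\<forall>v\<in>V. Y v \<in> sets unit_interval \<and> 0 < measure unit_interval (Y v) \<and>
        {x \<in> A v. x (je v) \<in> Y v} \<in> null_sets P"
      by (rule bchoice[THEN exE])
    then have Y: "\<And>v. v \<in> V \<Longrightarrow> Y v \<in> sets unit_interval"
      "\<And>v. v \<in> V \<Longrightarrow> 0 < measure unit_interval (Y v)"
      "\<And>v. v \<in> V \<Longrightarrow> {x \<in> A v. x (je v) \<in> Y v} \<in> null_sets P"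
      by blast+
    \<comment> \<open>Injectivity of \<open>je\<close> makes the conditions concern distinct
      coordinates, so the measure of the box is a product of positive numbers.\<close>
    define B where "B = {x \<in> space P. \<forall>v\<in>V. x (je v) \<in> Y v}"
    have "measure P B = (\<Prod>v\<in>V. measure unit_interval (Y v))"
      unfolding B_def P_def using fin je_inj je(1) Y(1) by (intro measure_cube_box) auto
    then have "0 < measure P B" using Y(2) by (simp add: prod_pos)
    define Z where "Z = (\<Union>v\<in>V. {x \<in> A v. x (je v) \<in> Y v})"
    have Z: "Z \<in> null_sets P" unfolding Z_def using fin Y(3) by (intro null_sets.finite_UN) auto
    have "measure P B \<le> measure P ((space P - (\<Union>i\<in>V. A i)) \<union> Z)"
    proof (rule P.finite_measure_mono)
      show "B \<subseteq> (space P - (\<Union>i\<in>V. A i)) \<union> Z" by (auto simp: B_def Z_def)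
      show "(space P - (\<Union>i\<in>V. A i)) \<union> Z \<in> sets P" using none[of V] Z by auto
    qed
    also have "\<dots> = measure P (space P - (\<Union>i\<in>V. A i))"
      using none[of V] Z by (intro measure_Un_null_set) auto
    finally show False using cover \<open>0 < measure P B\<close> by simp
  qed
  then show ?thesis
    unfolding H_def[symmetric] bigraph_interior_borel[OF H(1)] H(2,3) P_def[symmetric] V_def[symmetric] N_def[symmetric]
    using p by auto
qed

lemma cyclic_a_gapful:
  fixes G :: "nat pair_pre_digraph"
  assumes G: "pair_graph G" "pverts G = {1..n}" and conn: "Digraph_Component.connected G"
    and cyc: "pre_digraph.cycle G c" "3 \<le> length c"
  shows "a_gapful G"
proof -
  interpret G: pair_graph G by (rule G)
  have E_sym: "(w, u) \<in> parcs G" if "(u, w) \<in> parcs G" for u w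
    using that G.pair_sym_arcs by (auto simp: symmetric_def elim: symE)
  have E_irrefl: "(u, u) \<notin> parcs G" for u using G.pair_no_loops by fastforce
  obtain \<sigma> where \<sigma>: "\<forall>v\<in>pverts G. (v, \<sigma> v) \<in> parcs G \<and> \<sigma> (\<sigma> v) \<noteq> v"
    using cycle_imp_nonbacktracking_map[OF G(1) conn cyc] by blast
  obtain u w where uw: "(u, w) \<in> parcs G"
    using cyc unfolding G.cycle_def G.awalk_def by (cases c) auto
  have cut: "\<exists>v\<in>{1..n} - W. \<exists>w\<in>W. (v, w) \<in> parcs G" if "W \<subseteq> {1..n}" "W \<noteq> {}" "W \<noteq> {1..n}" for W
    using connected_cut[OF G(1) conn, of W] that G(2) by simp
  obtain p :: real where p: "0 < p" "p < 1" and zero: "indep_poly (parcs G) (\<lambda>_. p) {1..n} = 0"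
    and pos: "\<And>S. S \<subset> {1..n} \<Longrightarrow> 0 < indep_poly (parcs G) (\<lambda>_. p) S"
    using ex_critical_probability[of "{1..n}" "parcs G" u w] E_sym E_irrefl cut uw
      G.in_arcsD1[OF uw] G.in_arcsD2[OF uw] G(2) by (metis finite_atLeastAtMost)
  define Es where "Es = (\<lambda>(u, w). {u, w}) ` parcs G"
  have "finite Es" unfolding Es_def using G.pair_finite_arcs by simp
  then obtain h where h: "bij_betw h {1..card Es} Es" using ex_bij_betw_nat_finite_1 by blast
  define H where "H = edge_bigraph n (card Es) h"
  have "h ` {1..card Es} = (\<lambda>(u, w). {u, w}) ` parcs G" using h by (simp add: bij_betw_def Es_def)
  then have base: "base_graph H = G" unfolding H_def by (rule base_graph_edge_bigraph[OF G])
  have "(\<lambda>_. p) \<in> bigraph_interior H"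
    unfolding H_def
  proof (rule critical_in_bigraph_interior[OF G conn _ _ p zero pos])
    show "bij_betw h {1..card Es} ((\<lambda>(u, w). {u, w}) ` parcs G)" using h by (simp add: Es_def)
    show "(v, \<sigma> v) \<in> parcs G \<and> \<sigma> (\<sigma> v) \<noteq> v" if "v \<in> {1..n}" for v using \<sigma> that G(2) by blast
  qed
  moreover have "(\<lambda>_. p) \<notin> abstract_interior G"
  proof (rule indep_poly_not_abstract_interior)
    show "0 \<le> indep_poly (parcs G) (\<lambda>_. p) S" if "S \<subseteq> pverts G" for S
      using pos[of S] zero that G(2) by (cases "S = {1..n}") (auto simp: less_imp_le psubset_eq)
  qed (use G(2) zero p E_sym E_irrefl in auto)
  ultimately have "gapful H"
    unfolding gapful_def base using p
    by (intro bexI[of _ "\<lambda>_. p"] exI[of _ 1]) auto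
  moreover have "is_bigraph H" by (auto simp: H_def is_bigraph_def edge_bigraph_def)
  ultimately show ?thesis unfolding a_gapful_def using base by blast
qed

theorem theorem8:
  fixes G :: "nat pair_pre_digraph" and n :: nat
  assumes "pair_graph G" and "pverts G = {1..n}" and "Digraph_Component.connected G"
  shows "a_gapless G \<longleftrightarrow> undirected_tree G"
  using assms tree_a_gapless[of G] cyclic_a_gapful[of G n] unfolding undirected_tree_def by blast

end
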